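(* Let $F$ be a field of characteristic $\neq 2$ and let $(R,c)=(F[h],h)$ with $h$ an indeterminate. For any knot $K$, $$s(K;F)=\bar s_h(K;F[h]),$$ where $s(K;F)$ is the Rasmussen $s$-invariant of $K$ over $F$ and $\bar s_h(K;F[h])$ is the invariant $\bar s_c$ for $(R,c)=(F[h],h)$.
   Context: Links and diagrams are oriented. For a commutative ring $R$ and $p,q\in R$, let $A_{p,q}=R[X]/(X^2-pX-q)$ be the Frobenius algebra with its usual multiplication $m$ and unit, counit $\epsilon(1)=0,\epsilon(X)=1$, and comultiplication $\Delta(1)=X\otimes1+1\otimes X-p\,1\otimes1$, $\Delta(X)=X\otimes X+q\,1\otimes1$. For a diagram $D$ with $n^+$ positive and $n^-$ negative crossings, a state $s$ is a choice of 0- or 1-resolution at each crossing (convention: the orientation preserving resolution of a positive crossing is its 0-resolution, that of a negative crossing is its 1-resolution); $|s|$ is the number of 1-resolutions, and $V(D,s)=A_{p,q}^{\otimes r(D,s)}$ has one factor for each of the $r(D,s)$ circles. $C_{p,q}(D;R)$ is the usual Khovanov cube complex built from $A_{p,q}$: $\bigoplus_{|s|=i}V(D,s)$ in homological degree $i-n^-$, differential the usual signed sum of maps induced by $m$ or $\Delta$; $H_{p,q}(D;R)$ is its homology. If $X^2-pX-q=(X-u)(X-v)$ with $u,v\in R$, put $\mathbf a=X-u$, $\mathbf b=X-v$. Color the regions of the plane cut out by the Seifert circles of $D$ in checkerboard fashion with the unbounded region white; color a Seifert circle $\mathbf a$ if it has a black region on its left, otherwise $\mathbf b$. The tensor product of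 these colors, in $V(D,s)$ for $s$ the orientation preserving state, is a cycle $\alpha(D)$. Let $\beta(D)=\alpha(-D)$, where $-D$ is $D$ with reversed orientation (i.e. $\mathbf a,\mathbf b$ exchanged). Definition of $\bar s_h(K;F[h])$: take $R=F[h]$, $(p,q)=(h,0)$, $u=0$, $v=h$ (the choice $(p,q)=(0,(h/2)^2)$, $u=-h/2$, $v=h/2$ gives canonically isomorphic homology with corresponding classes). Let $k_h(D)$ be the largest $k\ge 0$ such that $[\alpha(D)]$ is divisible by $h^k$ in the quotient of $H_{h,0}(D;F[h])$ by its torsion submodule. Then $\bar s_h(K;F[h])=2k_h(D)+w(D)-r(D)+1$ for any diagram $D$ of $K$, with $w$ the writhe and $r$ the number of Seifert circles; this is independent of $D$. Definition of $s(K;F)$: take $R=F$, $(p,q)=(0,1)$, $u=-1$, $v=1$ (Lee homology over $F$). For an enhanced state $x=e_1\otimes\cdots\otimes e_r\in V(D,s)$ with $e_i\in\{1,X\}$ put $\mathrm{qdeg}(x)=\sum_i\deg(e_i)+|s|+r(D,s)+n^+-2n^-$, where $\deg 1=0$, $\deg X=-2$; for a general chain, $\mathrm{qdeg}$ is the minimum over the enhanced states occurring with non-zero coefficient, and for a homology class $\gamma$, $\mathrm{qdeg}(\gamma)=\max\{\mathrm{qdeg}(x):[x]=\gamma\}$. Then $s(K;F)=\tfrac12\left(\mathrm{qdeg}[\alpha(D)+\beta(D)]+\mathrm{qdeg}[\alpha(D)-\beta(D)]\right)$ for any diagram $D$ of $K$. *)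

theory Defs
  imports "HOL-Computational_Algebra.Computational_Algebra"
begin

section \<open>Oriented diagrams\<close>

text \<open>
  A diagram is recorded as an oriented planar 4-valent map.  Each crossing is drawn with both strands
  pointing upwards; its fields name the edges at the bottom left, bottom right, top left and
  top right.  So the two strands run from \<open>bl\<close> to \<open>tr\<close> and from \<open>br\<close> to \<open>tl\<close>, and
  the crossing is positive iff the strand from \<open>bl\<close> to \<open>tr\<close> is the upper one.
  An edge that meets no crossing is a circle without crossings.
\<close>

datatype crossing =
  Crossing (positive: bool) (bl: nat) (br: nat) (tl: nat) (tr: nat)

datatype hand = Lft | Rgt

text \<open>
  A side \<open>(e, Lft)\<close> or \<open>(e, Rgt)\<close> stands for the points near the edge \<open>e\<close> to its left or right,
  with respect to the orientation of \<open>e\<close>.  The field \<open>outer\<close> is some side lying in the unbounded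
  region of the plane.  The order of the list of crossings only enters the signs in the cube.
\<close>

type_synonym side = "nat \<times> hand"

record diagram =
  edges :: "nat set"
  crossings :: "crossing list"
  outer :: side

definition sides :: "diagram \<Rightarrow> side set" where
  "sides D = edges D \<times> UNIV"

abbreviation equiv_closure :: "('a \<times> 'a) set \<Rightarrow> ('a \<times> 'a) set" where
  "equiv_closure r \<equiv> (r \<union> r\<inverse>)\<^sup>*"

text \<open>The four corners at a crossing: left, right, top and bottom.\<close>

definition corners :: "crossing \<Rightarrow> (side \<times> side) set" where
  "corners c =
     {((bl c, Lft), (tl c, Lft)), ((br c, Rgt), (tr c, Rgt)),
      ((tl c, Rgt), (tr c, Lft)), ((bl c, Rgt), (br c, Lft))}"

definition faces :: "diagram \<Rightarrow> side set set" where
  "faces D = sides D // equiv_closure (\<Union>c\<in>set (crossings D). corners c)"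

definition in_edges :: "diagram \<Rightarrow> nat list" where
  "in_edges D = concat (map (\<lambda>c. [bl c, br c]) (crossings D))"

definition out_edges :: "diagram \<Rightarrow> nat list" where
  "out_edges D = concat (map (\<lambda>c. [tl c, tr c]) (crossings D))"

definition strands :: "diagram \<Rightarrow> (nat \<times> nat) set" where
  "strands D = (\<Union>c\<in>set (crossings D). {(bl c, tr c), (br c, tl c)})"

text \<open>
  A knot diagram has one component: following the strands, every edge is reached from every edge.
  In particular it is connected, so that planarity is Euler's formula \<open>V - E + F = 2\<close>.
  With \<open>n\<close> crossings there are \<open>2 * n\<close> edges, hence \<open>n + 2\<close> faces; this also is the correct
  number for the circle without crossings, which has a single edge and two faces.
\<close>

definition knot_diagram :: "diagram \<Rightarrow> bool" where
  "knot_diagram D \<longleftrightarrow>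
     finite (edges D) \<and> edges D \<noteq> {} \<and>
     distinct (in_edges D) \<and> distinct (out_edges D) \<and>
     set (in_edges D) = set (out_edges D) \<and> set (in_edges D) \<subseteq> edges D \<and>
     (\<forall>e\<in>edges D. \<forall>f\<in>edges D. (e, f) \<in> (strands D)\<^sup>*) \<and>
     card (faces D) = length (crossings D) + 2 \<and>
     outer D \<in> sides D"

definition n_plus :: "diagram \<Rightarrow> nat" where
  "n_plus D = card {i. i < length (crossings D) \<and> positive (crossings D ! i)}"

definition n_minus :: "diagram \<Rightarrow> nat" where
  "n_minus D = card {i. i < length (crossings D) \<and> \<not> positive (crossings D ! i)}"

definition writhe :: "diagram \<Rightarrow> int" where
  "writhe D = int (n_plus D) - int (n_minus D)"

text \<open>Reversal of the orientation; the crossings are turned by half a turn.\<close>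

fun opposite :: "hand \<Rightarrow> hand" where
  "opposite Lft = Rgt"
| "opposite Rgt = Lft"

definition reverse_crossing :: "crossing \<Rightarrow> crossing" where
  "reverse_crossing c = Crossing (positive c) (tr c) (tl c) (br c) (bl c)"

definition reverse_diagram :: "diagram \<Rightarrow> diagram" where
  "reverse_diagram D =
     D\<lparr>crossings := map reverse_crossing (crossings D),
       outer := (fst (outer D), opposite (snd (outer D)))\<rparr>"


section \<open>Resolutions\<close>

text \<open>
  A state is the set of (indices of) crossings that get their 1-resolution.  A circle of a resolution
  is represented by the set of edges it runs through.
\<close>

definition states :: "diagram \<Rightarrow> nat set set" where
  "states D = Pow {..<length (crossings D)}"

definition oriented_arcs :: "crossing \<Rightarrow> (nat \<times> nat) set" where
  "oriented_arcs c = {(bl c, tl c), (br c, tr c)}"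

definition unoriented_arcs :: "crossing \<Rightarrow> (nat \<times> nat) set" where
  "unoriented_arcs c = {(bl c, br c), (tl c, tr c)}"

definition resolution :: "crossing \<Rightarrow> bool \<Rightarrow> (nat \<times> nat) set" where
  "resolution c one = (if positive c \<noteq> one then oriented_arcs c else unoriented_arcs c)"

definition circles :: "diagram \<Rightarrow> nat set \<Rightarrow> nat set set" where
  "circles D s =
     edges D // equiv_closure (\<Union>i<length (crossings D). resolution (crossings D ! i) (i \<in> s))"

definition oriented_state :: "diagram \<Rightarrow> nat set" where
  "oriented_state D = {i. i < length (crossings D) \<and> \<not> positive (crossings D ! i)}"

abbreviation seifert_circles :: "diagram \<Rightarrow> nat set set" where
  "seifert_circles D \<equiv> circles D (oriented_state D)"


section \<open>The cube complex\<close>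

text \<open>
  Structure constants of \<open>A = R[X]/(X\<^sup>2 - p X - q)\<close> in the basis \<open>1, X\<close>.
  The product of two basis elements, \<open>k\<close> of which are \<open>X\<close>, is \<open>X ^ k\<close>; \<open>mult_coeff p q k l\<close> is its
  coefficient at \<open>X ^ l\<close>.  The comultiplication is symmetric, and \<open>comult_coeff p q k l\<close>
  is the coefficient in \<open>\<Delta>(X ^ k)\<close> at each tensor product of two basis elements of which \<open>l\<close> are \<open>X\<close>:
  \<open>\<Delta>(1) = X \<otimes> 1 + 1 \<otimes> X - p 1 \<otimes> 1\<close> and \<open>\<Delta>(X) = X \<otimes> X + q 1 \<otimes> 1\<close>.
\<close>

definition mult_coeff :: "'r::comm_ring_1 \<Rightarrow> 'r \<Rightarrow> nat \<Rightarrow> nat \<Rightarrow> 'r" where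
  "mult_coeff p q k l =
     (if k = 2 then (if l = 0 then q else p) else if k = l then 1 else 0)"

definition comult_coeff :: "'r::comm_ring_1 \<Rightarrow> 'r \<Rightarrow> nat \<Rightarrow> nat \<Rightarrow> 'r" where
  "comult_coeff p q k l =
     (if k = 0 then (if l = 0 then - p else if l = 1 then 1 else 0)
      else (if l = 0 then q else if l = 1 then 0 else 1))"

text \<open>
  An enhanced state \<open>(s, T)\<close> is the basis element of the tensor power of \<open>A\<close> over the circles of \<open>s\<close>
  with factor \<open>X\<close> at the circles in \<open>T\<close> and factor \<open>1\<close> at the others.  Chains are given by their
  coefficients, with all homological degrees taken together.
\<close>

type_synonym enhanced_state = "nat set \<times> nat set set"

type_synonym 'r chain = "enhanced_state \<Rightarrow> 'r"

definition enhanced_states :: "diagram \<Rightarrow> enhanced_state set" where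
  "enhanced_states D = (SIGMA s:states D. Pow (circles D s))"

definition chains :: "diagram \<Rightarrow> ('r::comm_ring_1) chain set" where
  "chains D = {x. \<forall>e. e \<notin> enhanced_states D \<longrightarrow> x e = 0}"

text \<open>
  Matrix entries of the map along the edge of the cube from \<open>s\<close> to \<open>insert j s\<close>.  The circles not
  touched by the change are those common to both states.  For planar diagrams the change always is
  a merge or a split, so the last alternative does not occur.
\<close>

definition edge_coeff ::
  "diagram \<Rightarrow> 'r::comm_ring_1 \<Rightarrow> 'r \<Rightarrow> nat set \<Rightarrow> nat \<Rightarrow> nat set set \<Rightarrow> nat set set \<Rightarrow> 'r" where
  "edge_coeff D p q s j T T' =
     (let C = circles D s; C' = circles D (insert j s); old = C - C'; new = C' - C in
      if T \<inter> (C \<inter> C') \<noteq> T' \<inter> (C \<inter> C') then 0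
      else if card old = 2 \<and> card new = 1 then
        mult_coeff p q (card (T \<inter> old)) (card (T' \<inter> new))
      else if card old = 1 \<and> card new = 2 then
        comult_coeff p q (card (T \<inter> old)) (card (T' \<inter> new))
      else 0)"

definition differential ::
  "diagram \<Rightarrow> 'r::comm_ring_1 \<Rightarrow> 'r \<Rightarrow> 'r chain \<Rightarrow> 'r chain" where
  "differential D p q x =
     (\<lambda>(s, T). if (s, T) \<in> enhanced_states D then
        \<Sum>j\<in>s. (- 1) ^ card {i\<in>s. i < j} *
          (\<Sum>S\<in>Pow (circles D (s - {j})). edge_coeff D p q (s - {j}) j S T * x (s - {j}, S))
      else 0)"

definition cycles :: "diagram \<Rightarrow> 'r::comm_ring_1 \<Rightarrow> 'r \<Rightarrow> 'r chain set" where
  "cycles D p q = {x \<in> chains D. differential D p q x = (\<lambda>_. 0)}"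

definition boundaries :: "diagram \<Rightarrow> 'r::comm_ring_1 \<Rightarrow> 'r \<Rightarrow> 'r chain set" where
  "boundaries D p q = differential D p q ` chains D"

text \<open>Homology classes are the cosets of the boundaries.\<close>

definition homology_class ::
  "diagram \<Rightarrow> 'r::comm_ring_1 \<Rightarrow> 'r \<Rightarrow> 'r chain \<Rightarrow> 'r chain set" where
  "homology_class D p q x = {y \<in> cycles D p q. (\<lambda>e. y e - x e) \<in> boundaries D p q}"

text \<open>The cycles whose homology class is a torsion element.\<close>

definition torsion_cycles :: "diagram \<Rightarrow> 'r::comm_ring_1 \<Rightarrow> 'r \<Rightarrow> 'r chain set" where
  "torsion_cycles D p q =
     {x \<in> cycles D p q. \<exists>r. r \<noteq> 0 \<and> (\<lambda>e. r * x e) \<in> boundaries D p q}"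

text \<open>Divisibility by \<open>c\<close> of the class of \<open>x\<close> in homology modulo torsion.\<close>

definition divisible_mod_torsion ::
  "diagram \<Rightarrow> 'r::comm_ring_1 \<Rightarrow> 'r \<Rightarrow> 'r \<Rightarrow> 'r chain \<Rightarrow> bool" where
  "divisible_mod_torsion D p q c x \<longleftrightarrow>
     (\<exists>y \<in> cycles D p q. (\<lambda>e. x e - c * y e) \<in> torsion_cycles D p q)"


section \<open>The canonical cycles\<close>

text \<open>
  Smoothing a crossing along the orientation joins its top and bottom faces.  The regions cut out by
  the Seifert circles therefore arise from the corners together with these channels.
\<close>

definition region_rel :: "diagram \<Rightarrow> (side \<times> side) set" where
  "region_rel D =
     equiv_closure (\<Union>c\<in>set (crossings D). insert ((bl c, Rgt), (tl c, Rgt)) (corners c))"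

definition seifert_regions :: "diagram \<Rightarrow> side set set" where
  "seifert_regions D = sides D // region_rel D"

definition region_of :: "diagram \<Rightarrow> side \<Rightarrow> side set" where
  "region_of D x = region_rel D `` {x}"

definition is_black_regions :: "diagram \<Rightarrow> side set set \<Rightarrow> bool" where
  "is_black_regions D B \<longleftrightarrow>
     B \<subseteq> seifert_regions D \<and> region_of D (outer D) \<notin> B \<and>
     (\<forall>e\<in>edges D. region_of D (e, Lft) \<in> B \<longleftrightarrow> region_of D (e, Rgt) \<notin> B)"

definition black_regions :: "diagram \<Rightarrow> side set set" where
  "black_regions D = (THE B. is_black_regions D B)"

definition black_on_left :: "diagram \<Rightarrow> nat set \<Rightarrow> bool" where
  "black_on_left D c \<longleftrightarrow> (\<exists>e\<in>c. region_of D (e, Lft) \<in> black_regions D)"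

text \<open>The tensor product of factors \<open>X - u\<close> and \<open>X - v\<close>, expanded in the basis of enhanced states.\<close>

definition alpha :: "'r::comm_ring_1 \<Rightarrow> 'r \<Rightarrow> diagram \<Rightarrow> 'r chain" where
  "alpha u v D =
     (\<lambda>(s, T). if s = oriented_state D \<and> T \<subseteq> seifert_circles D then
        \<Prod>c\<in>seifert_circles D. if c \<in> T then 1 else if black_on_left D c then - u else - v
      else 0)"

text \<open>\<open>D\<close> and its reverse have the same edges, crossing signs and resolutions, hence the same chains.\<close>

definition beta :: "'r::comm_ring_1 \<Rightarrow> 'r \<Rightarrow> diagram \<Rightarrow> 'r chain" where
  "beta u v D = alpha u v (reverse_diagram D)"


section \<open>The two invariants\<close>

text \<open>In \<open>F[h]\<close> the indeterminate \<open>h\<close> is \<open>[:0, 1:]\<close>.\<close>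

definition k_h :: "'f::field itself \<Rightarrow> diagram \<Rightarrow> nat" where
  "k_h _ D =
     (let h = [:0, 1:] :: 'f poly
      in GREATEST k. divisible_mod_torsion D h 0 (h ^ k) (alpha 0 h D))"

definition s_bar_h :: "'f::field itself \<Rightarrow> diagram \<Rightarrow> int" where
  "s_bar_h F D = 2 * int (k_h F D) + writhe D - int (card (seifert_circles D)) + 1"

definition qdeg_state :: "diagram \<Rightarrow> enhanced_state \<Rightarrow> int" where
  "qdeg_state D = (\<lambda>(s, T).
     - 2 * int (card T) + int (card s) + int (card (circles D s)) + int (n_plus D)
       - 2 * int (n_minus D))"

text \<open>The degree of the zero chain and of the zero class is irrelevant and left unspecified.\<close>

definition qdeg_chain :: "diagram \<Rightarrow> 'r::comm_ring_1 chain \<Rightarrow> int" where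
  "qdeg_chain D x = Min (qdeg_state D ` {e \<in> enhanced_states D. x e \<noteq> 0})"

definition qdeg_class :: "diagram \<Rightarrow> 'r::comm_ring_1 chain set \<Rightarrow> int" where
  "qdeg_class D \<gamma> = Max (qdeg_chain D ` \<gamma>)"

definition s_invariant :: "'f::field itself \<Rightarrow> diagram \<Rightarrow> rat" where
  "s_invariant _ D =
     (let a = alpha (- 1) 1 D :: 'f chain;
          b = beta (- 1) 1 D :: 'f chain;
          cls = homology_class D 0 1
      in (of_int (qdeg_class D (cls (\<lambda>e. a e + b e))) +
          of_int (qdeg_class D (cls (\<lambda>e. a e - b e)))) / 2)"

end

theory Submission
  imports Defs
begin

text \<open>
  Evaluating \<open>X\<close> at the two roots \<open>u\<close>, \<open>v\<close> circle by circle turns the cube into a sum over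
  colorings of the edges, in which the differential only depends on \<open>v - u\<close>, and \<open>\<alpha>\<close>, \<open>\<beta>\<close> are
  concentrated at the checkerboard coloring and its opposite.  Hence \<open>\<alpha>\<close>, \<open>\<beta>\<close> are cycles,
  independent modulo boundaries, and \<open>X \<mapsto> X + 1\<close> identifies the complexes for the roots
  \<open>(0, 2)\<close> and \<open>(-1, 1)\<close>.

  The complex over \<open>F[h]\<close> is the graded (Rees) form of the filtered complex for the roots \<open>(0, 2)\<close>:
  \<open>[\<alpha>]\<close> is divisible by \<open>h ^ k\<close> modulo torsion iff, after setting \<open>h = 2\<close>, it has a representative of
  filtration at least \<open>w - r + 2 k\<close>.  So \<open>2 k\<^sub>h + w - r\<close> is the filtration degree of
  \<open>[\<alpha>]\<close> in Lee homology.  The Lee differential respects \<open>qdeg\<close> modulo 4 and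
  \<open>\<alpha> + \<beta>\<close>, \<open>\<alpha> - \<beta>\<close> lie in residues differing by 2; multiplication by \<open>X\<close> at a point
  exchanges them up to sign and lowers the filtration by at most 2.  Their degrees thus differ by exactly 2,
  and that of \<open>[\<alpha>]\<close> is the smaller one.
\<close>

section \<open>Tensors and their evaluations\<close>

text \<open>The cycle property, the shift and the action of \<open>X\<close> are verified on
  evaluations, where each edge of the cube acts by a scalar. Only injectivity of the evaluation is
  used, so the argument also serves \<open>F[h]\<close> with roots \<open>0\<close>,
  \<open>h\<close>, whose difference is not a unit. The geometric obstacle is that the colors of the
  Seifert circles come from a definite description over the regions of an abstract planar map.
  Existence and uniqueness of the checkerboard coloring have to be extracted from connectedness and
  Euler's formula, by counting over the field with two elements. The indeterminate has degree
  \<open>-2\<close> because \<open>X\<close> has, and \<open>X * X = h * X\<close>. The value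
  \<open>h = 2\<close> is forced: a shift of \<open>X\<close> preserves the difference of the roots,
  which is 2 for \<open>-1\<close>, \<open>1\<close>. Residues modulo 4 appear because
  \<open>q = 1\<close> stands for a scalar of degree \<open>-4\<close>. Torsion has to be divided
  out because a chain bounding a difference of representatives may contain terms of low degree, and
  homogenizing it costs a power of \<open>h\<close>.\<close>

definition compatible :: "nat set set \<Rightarrow> nat set \<Rightarrow> bool" where
  "compatible C G \<longleftrightarrow> (\<forall>c\<in>C. c \<subseteq> G \<or> c \<inter> G = {})"

text \<open>A coloring is a set of edges and not of circles, so that the same \<open>G\<close> can
  be evaluated in adjacent states, whose circles differ.\<close>

definition root_at :: "'r \<Rightarrow> 'r \<Rightarrow> nat set \<Rightarrow> nat set \<Rightarrow> 'r" where
  "root_at u v G c = (if c \<subseteq> G then v else u)"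

definition eval_tensor ::
  "'r::comm_ring_1 \<Rightarrow> 'r \<Rightarrow> nat set set \<Rightarrow> (nat set set \<Rightarrow> 'r) \<Rightarrow> nat set \<Rightarrow> 'r" where
  "eval_tensor u v C f G = (\<Sum>S\<in>Pow C. f S * (\<Prod>c\<in>S. root_at u v G c))"

lemma sum_Pow_insert:
  assumes "finite C" "c \<notin> C"
  shows "(\<Sum>S\<in>Pow (insert c C). f S) = (\<Sum>S\<in>Pow C. f S + f (insert c S))"
proof -
  have "inj_on (insert c) (Pow C)"
    using assms(2) by (auto simp: inj_on_def)
  moreover have "Pow C \<inter> insert c ` Pow C = {}"
    using assms(2) by auto
  ultimately show ?thesis
    using assms(1) by (simp add: Pow_insert sum.union_disjoint sum.reindex sum.distrib)
qed

text \<open>A polynomial of degree at most one in each variable that vanishes on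
  \<open>{u, v}\<close> to the power \<open>C\<close> is zero. Fixing one variable leaves such a
  polynomial in the others, and a linear polynomial with two different zeros vanishes.\<close>

lemma tensor_eq_zero:
  fixes u v :: "'r::idom"
  assumes "finite C" "u \<noteq> v"
    and "\<And>D. D \<subseteq> C \<Longrightarrow> (\<Sum>S\<in>Pow C. f S * (\<Prod>c\<in>S. if c \<in> D then v else u)) = 0"
    and "S \<subseteq> C"
  shows "f S = 0"
  using assms(1,3,4)
proof (induction C arbitrary: f S)
  case empty
  then show ?case by auto
next
  case (insert c C)
  have step: "f S + w * f (insert c S) = 0" if w: "w \<in> {u, v}" and S: "S \<subseteq> C" for w S
  proof (rule insert.IH[OF _ S])
    fix D assume D: "D \<subseteq> C"
    \<comment> \<open>\<open>D'\<close> gives the variable of \<open>c\<close> the value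
      \<open>w\<close> and agrees with \<open>D\<close> elsewhere.\<close>
    define D' where "D' = (if w = v then insert c D else D)"
    have c: "(if c \<in> D' then v else u) = w"
      using w D insert.hyps \<open>u \<noteq> v\<close> by (auto simp: D'_def)
    have D': "b \<in> D' \<longleftrightarrow> b \<in> D" if "b \<in> C" for b
      using that insert.hyps by (auto simp: D'_def)
    have "(\<Sum>S\<in>Pow C. f S * (\<Prod>c\<in>S. if c \<in> D' then v else u)
        + f (insert c S) * (\<Prod>c\<in>insert c S. if c \<in> D' then v else u)) = 0"
    proof -
      have "D' \<subseteq> insert c C"
        using D by (auto simp: D'_def)
      from insert.prems(1)[OF this] show ?thesis
        by (simp only: sum_Pow_insert[OF insert.hyps])
    qed
    also have "(\<Sum>S\<in>Pow C. f S * (\<Prod>c\<in>S. if c \<in> D' then v else u)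
        + f (insert c S) * (\<Prod>c\<in>insert c S. if c \<in> D' then v else u))
      = (\<Sum>S\<in>Pow C. (f S + w * f (insert c S)) * (\<Prod>c\<in>S. if c \<in> D then v else u))"
    proof (rule sum.cong[OF refl])
      fix S assume S: "S \<in> Pow C"
      have "finite S" "c \<notin> S"
        using S insert.hyps by (auto intro: finite_subset)
      moreover have "(\<Prod>c\<in>S. if c \<in> D' then v else u) = (\<Prod>c\<in>S. if c \<in> D then v else u)"
        using S D' by (intro prod.cong) auto
      ultimately show "f S * (\<Prod>c\<in>S. if c \<in> D' then v else u)
        + f (insert c S) * (\<Prod>c\<in>insert c S. if c \<in> D' then v else u)
        = (f S + w * f (insert c S)) * (\<Prod>c\<in>S. if c \<in> D then v else u)"
        using c by (simp add: algebra_simps)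
    qed
    finally show "(\<Sum>S\<in>Pow C. (f S + w * f (insert c S))
        * (\<Prod>c\<in>S. if c \<in> D then v else u)) = 0" .
  qed
  have both: "f S = 0 \<and> f (insert c S) = 0" if S: "S \<subseteq> C" for S
  proof -
    have 1: "f S + u * f (insert c S) = 0" and 2: "f S + v * f (insert c S) = 0"
      using step S by auto
    have "(u - v) * f (insert c S) = (f S + u * f (insert c S)) - (f S + v * f (insert c S))"
      by (simp add: algebra_simps)
    then have "f (insert c S) = 0"
      using \<open>u \<noteq> v\<close> 1 2 by simp
    then show ?thesis
      using 1 by simp
  qed
  show ?case
  proof (cases "c \<in> S")
    case True
    then have "S = insert c (S - {c})" "S - {c} \<subseteq> C"
      using insert.prems(2) by auto
    then show ?thesis
      using both by metis
  next
    case False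
    then show ?thesis
      using both insert.prems(2) by auto
  qed
qed

definition partition_of :: "nat set set \<Rightarrow> nat set \<Rightarrow> bool" where
  "partition_of C E \<longleftrightarrow> finite C \<and> \<Union>C = E \<and> {} \<notin> C \<and> (\<forall>c\<in>C. \<forall>d\<in>C. c \<noteq> d \<longrightarrow> c \<inter> d = {})"

lemma partition_ofD:
  assumes "partition_of C E" "c \<in> C" "d \<in> C" "e \<in> c" "e \<in> d"
  shows "c = d"
  using assms unfolding partition_of_def by (meson disjoint_iff)

text \<open>Each subset \<open>D\<close> of the circles is realized by the compatible coloring
  \<open>\<Union>D\<close>, so compatible colorings reach every point that
  \<open>tensor_eq_zero\<close> asks for.\<close>

lemma eval_tensor_inj:
  fixes u v :: "'r::idom"
  assumes C: "partition_of C E" and "u \<noteq> v"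
    and eq: "\<And>G. compatible C G \<Longrightarrow> eval_tensor u v C f G = eval_tensor u v C g G"
    and "S \<subseteq> C"
  shows "f S = g S"
proof -
  have "f S - g S = 0"
  proof (rule tensor_eq_zero[OF _ \<open>u \<noteq> v\<close> _ \<open>S \<subseteq> C\<close>])
    show "finite C"
      using C by (simp add: partition_of_def)
    fix D assume D: "D \<subseteq> C"
    have mem: "c \<subseteq> \<Union>D \<longleftrightarrow> c \<in> D" if "c \<in> C" for c
    proof
      assume "c \<subseteq> \<Union>D"
      moreover obtain e where "e \<in> c"
        using \<open>c \<in> C\<close> C by (metis partition_of_def ex_in_conv)
      ultimately obtain d where "d \<in> D" "e \<in> d" by auto
      then show "c \<in> D"
        using partition_ofD[OF C, of c d e] that D \<open>e \<in> c\<close> by auto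
    qed auto
    have "compatible C (\<Union>D)"
      unfolding compatible_def
    proof
      fix c assume "c \<in> C"
      then have "d = c" if "d \<in> D" "e \<in> d" "e \<in> c" for d e
        using partition_ofD[OF C, of d c e] that D by auto
      then show "c \<subseteq> \<Union>D \<or> c \<inter> \<Union>D = {}"
        by blast
    qed
    moreover have "eval_tensor u v C h (\<Union>D)
        = (\<Sum>S\<in>Pow C. h S * (\<Prod>c\<in>S. if c \<in> D then v else u))" for h
      unfolding eval_tensor_def root_at_def using mem
      by (intro sum.cong refl arg_cong2[of _ _ _ _ "(*)"] prod.cong) auto
    ultimately show "(\<Sum>S\<in>Pow C. (f S - g S) * (\<Prod>c\<in>S. if c \<in> D then v else u)) = 0"
      using eq[of "\<Union>D"] by (simp add: left_diff_distrib sum_subtractf)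
  qed
  then show ?thesis by simp
qed

text \<open>
  The tensor \<open>f\<close> is determined by its values under the algebra maps \<open>X \<mapsto> u\<close>, \<open>X \<mapsto> v\<close> on the
  factors.  In terms of these, a merge is the pullback along the map of circles, and a split
  vanishes when the two new circles have different colors and otherwise multiplies by
  \<open>\<plusminus>(v - u)\<close>.  Only \<open>v - u\<close> enters.
\<close>

definition edge_weight :: "'r::comm_ring_1 \<Rightarrow> nat set set \<Rightarrow> nat set set \<Rightarrow> nat set \<Rightarrow> 'r" where
  "edge_weight d C C' G =
     (if card (C - C') = 2 \<and> card (C' - C) = 1 then 1
      else if card (C - C') = 1 \<and> card (C' - C) = 2 then
        (if \<forall>c\<in>C' - C. c \<subseteq> G then d else if \<forall>c\<in>C' - C. c \<inter> G = {} then - d else 0)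
      else 0)"

lemma Union_new_circles:
  assumes C: "partition_of C E" and C': "partition_of C' E"
  shows "\<Union>(C - C') \<subseteq> \<Union>(C' - C)"
proof
  fix e assume "e \<in> \<Union>(C - C')"
  then obtain c where c: "c \<in> C" "c \<notin> C'" "e \<in> c"
    by auto
  then have "e \<in> E" using C by (auto simp: partition_of_def)
  then obtain c' where c': "c' \<in> C'" "e \<in> c'"
    using C' by (auto simp: partition_of_def)
  then have "c' \<notin> C"
    using partition_ofD[OF C, of c c' e] c by auto
  then show "e \<in> \<Union>(C' - C)" using c' by auto
qed

text \<open>A nonzero weight forces the new circles to have one common color, and each lost circle
  is covered by them. Thus a coloring that matters for the target also makes sense at the
  source.\<close>

lemma edge_weight_compatible:
  assumes C: "partition_of C E" and C': "partition_of C' E" and G: "compatible C' G"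
    and w: "edge_weight d C C' G \<noteq> 0"
  shows "compatible C G"
  unfolding compatible_def
proof
  fix c assume c: "c \<in> C"
  show "c \<subseteq> G \<or> c \<inter> G = {}"
  proof (cases "c \<in> C'")
    case True
    then show ?thesis using G by (auto simp: compatible_def)
  next
    case False
    then have *: "c \<subseteq> \<Union>(C' - C)" using Union_new_circles[OF C C'] c by auto
    have "(\<forall>c\<in>C' - C. c \<subseteq> G) \<or> (\<forall>c\<in>C' - C. c \<inter> G = {})"
    proof (cases "card (C' - C) = 1")
      case True
      then obtain n where "C' - C = {n}"
        by (auto simp: card_1_singleton_iff)
      then show ?thesis using G unfolding compatible_def by auto
    next
      case False
      then show ?thesis using w by (auto simp: edge_weight_def split: if_splits)
    qed
    then show ?thesis using * by blast
  qed
qed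

lemma sum_Pow_Int_eq:
  assumes "finite C'" "A \<subseteq> C' \<inter> C"
  shows "(\<Sum>T\<in>Pow C'. if A = T \<inter> (C \<inter> C') then f T else 0) = (\<Sum>V\<in>Pow (C' - C). f (A \<union> V))"
proof -
  have "(\<Sum>T\<in>Pow C'. if A = T \<inter> (C \<inter> C') then f T else 0)
      = (\<Sum>T\<in>{T\<in>Pow C'. A = T \<inter> (C \<inter> C')}. f T)"
    using assms(1) by (intro sum.inter_filter[symmetric]) auto
  also have "\<dots> = (\<Sum>V\<in>Pow (C' - C). f (A \<union> V))"
    by (rule sum.reindex_bij_witness[of _ "\<lambda>V. A \<union> V" "\<lambda>T. T - C"])
      (use assms(2) in \<open>auto simp: Un_Diff intro!: arg_cong[of _ _ f]\<close>)
  finally show ?thesis .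
qed

text \<open>Evaluation is multiplicative over the circles and the untouched ones contribute the same
  factor on both sides, so all reduces to an identity on the touched circles.\<close>

lemma eval_tensor_edge:
  fixes u v :: "'r::comm_ring_1"
  assumes C: "partition_of C E" and C': "partition_of C' E" and G: "compatible C' G"
    and m: "\<And>S T. m S T = (if S \<inter> (C \<inter> C') \<noteq> T \<inter> (C \<inter> C') then 0
      else if card (C - C') = 2 \<and> card (C' - C) = 1 then
        mult_coeff (u + v) (- (u * v)) (card (S \<inter> (C - C'))) (card (T \<inter> (C' - C)))
      else if card (C - C') = 1 \<and> card (C' - C) = 2 then
        comult_coeff (u + v) (- (u * v)) (card (S \<inter> (C - C'))) (card (T \<inter> (C' - C)))
      else 0)"
  shows "eval_tensor u v C' (\<lambda>T. \<Sum>S\<in>Pow C. m S T * f S) G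
    = edge_weight (v - u) C C' G * eval_tensor u v C f G"
proof -
  define val where "val = root_at u v G"
  define M where "M k l = (if card (C - C') = 2 \<and> card (C' - C) = 1 then
        mult_coeff (u + v) (- (u * v)) k l
      else if card (C - C') = 1 \<and> card (C' - C) = 2 then
        comult_coeff (u + v) (- (u * v)) k l else 0)" for k l
  have fin: "finite C" "finite C'"
    using C C' by (auto simp: partition_of_def)
  have valr: "val c = v \<and> c \<subseteq> G \<or> val c = u \<and> c \<inter> G = {} \<and> \<not> c \<subseteq> G" if "c \<in> C'" for c
  proof -
    have "c \<noteq> {}" "c \<subseteq> G \<or> c \<inter> G = {}"
      using that C' G by (auto simp: compatible_def partition_of_def)
    then show ?thesis
      by (auto simp: val_def root_at_def)
  qed
  have cov: "\<Union>(C - C') = \<Union>(C' - C)"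
    using Union_new_circles[OF C C'] Union_new_circles[OF C' C] by auto
  \<comment> \<open>For a merge the common value is a root of \<open>X^2 = (u + v) X - u v\<close>.
    For a split with values \<open>x\<close>, \<open>y\<close>, the images of \<open>1\<close> and
    \<open>X\<close> evaluate to \<open>x + y - (u + v)\<close> and \<open>x y - u v\<close>; both
    vanish if \<open>x\<close>, \<open>y\<close> are different roots.\<close>
  have key: "(\<Sum>V\<in>Pow (C' - C). M (card U) (card V) * prod val V)
      = edge_weight (v - u) C C' G * prod val U" if U: "U \<subseteq> C - C'" for U
  proof -
    have finU: "finite U" using U fin finite_subset by auto
    consider (merge) "card (C - C') = 2 \<and> card (C' - C) = 1"
      | (split) "card (C - C') = 1 \<and> card (C' - C) = 2"
      | (none) "\<not> (card (C - C') = 2 \<and> card (C' - C) = 1)"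
        "\<not> (card (C - C') = 1 \<and> card (C' - C) = 2)"
      by auto
    then show ?thesis
    proof cases
      case merge
      then obtain n where n: "C' - C = {n}"
        by (auto simp: card_1_singleton_iff)
      obtain a b where ab: "C - C' = {a, b}" "a \<noteq> b"
        using merge by (auto simp: card_2_iff)
      have nn: "n = a \<union> b" using cov n ab by auto
      have ne: "a \<noteq> {}" "b \<noteq> {}" using ab C by (auto simp: partition_of_def)
      have va: "val a = val n" "val b = val n"
        using valr[of n] n ne nn by (auto simp: val_def root_at_def)
      have "n \<in> C'" using n by auto
      from valr[OF this] have sq: "val n * val n = (u + v) * val n - u * v"
        by (auto simp: algebra_simps)
      have P: "Pow (C' - C) = {{}, {n}}"
        using n by (auto simp: Pow_insert)
      have S: "(\<Sum>V\<in>Pow (C' - C). M k (card V) * prod val V) = M k 0 + M k 1 * val n" for k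
        unfolding P by simp
      have M: "M k l = mult_coeff (u + v) (- (u * v)) k l" for k l
        using merge by (simp add: M_def)
      have W: "edge_weight (v - u) C C' G = 1"
        using merge by (simp add: edge_weight_def)
      consider "U = {}" | "U = {a}" | "U = {b}" | "U = {a, b}"
        using U ab by auto
      then show ?thesis
        unfolding S W unfolding M by cases (simp_all add: mult_coeff_def va sq ab(2))
    next
      case split
      then obtain n where n: "C - C' = {n}"
        by (auto simp: card_1_singleton_iff)
      obtain a b where ab: "C' - C = {a, b}" "a \<noteq> b"
        using split by (auto simp: card_2_iff)
      have nn: "n = a \<union> b" using cov n ab by auto
      have ne: "a \<noteq> {}" "b \<noteq> {}" using ab C' by (auto simp: partition_of_def)
      have abC: "a \<in> C'" "b \<in> C'" using ab by auto
      have ia: "a \<inter> G = {} \<longleftrightarrow> \<not> a \<subseteq> G" and ib: "b \<inter> G = {} \<longleftrightarrow> \<not> b \<subseteq> G"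
        using valr[OF abC(1)] valr[OF abC(2)] ne by auto
      have va: "val a = (if a \<subseteq> G then v else u)" and vb: "val b = (if b \<subseteq> G then v else u)"
        by (auto simp: val_def root_at_def)
      have vn: "val n = v" if "a \<subseteq> G" "b \<subseteq> G"
        using that nn by (auto simp: val_def root_at_def)
      have vn': "val n = u" if "\<not> a \<subseteq> G"
        using that nn by (auto simp: val_def root_at_def)
      have P: "Pow (C' - C) = {{}, {a}, {b}, {a, b}}"
        using ab by (auto simp: Pow_insert)
      have W: "edge_weight (v - u) C C' G = (if a \<subseteq> G \<and> b \<subseteq> G then v - u
          else if a \<inter> G = {} \<and> b \<inter> G = {} then u - v else 0)"
        using split ab ne by (auto simp: edge_weight_def)
      have S: "(\<Sum>V\<in>Pow (C' - C). M k (card V) * prod val V)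
          = M k 0 + M k 1 * (val a + val b) + M k 2 * (val a * val b)" for k
        unfolding P using ab(2) by (simp add: insert_eq_iff algebra_simps numeral_2_eq_2)
      have M: "M k l = comult_coeff (u + v) (- (u * v)) k l" for k l
        using split by (simp add: M_def)
      consider "U = {}" | "U = {n}"
        using U n by auto
      then show ?thesis
        unfolding W S unfolding M ia ib va vb
        by cases (cases "a \<subseteq> G"; cases "b \<subseteq> G";
            simp add: comult_coeff_def algebra_simps vn vn')+
    next
      case none
      then show ?thesis by (auto simp: M_def edge_weight_def)
    qed
  qed
  have "eval_tensor u v C' (\<lambda>T. \<Sum>S\<in>Pow C. m S T * f S) G
      = (\<Sum>S\<in>Pow C. \<Sum>T\<in>Pow C'. m S T * f S * prod val T)"
    unfolding eval_tensor_def val_def by (subst sum.swap) (simp add: sum_distrib_right)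
  also have "\<dots> = (\<Sum>S\<in>Pow C. edge_weight (v - u) C C' G * (f S * prod val S))"
  proof (rule sum.cong[OF refl])
    fix S assume S: "S \<in> Pow C"
    have finS: "finite S" using S fin finite_subset by auto
    \<comment> \<open>Only those \<open>T\<close> contribute that agree with \<open>S\<close> on the
      common circles; such a \<open>T\<close> amounts to its part \<open>V\<close> among the new
      circles.\<close>
    have "(\<Sum>T\<in>Pow C'. m S T * f S * prod val T)
      = (\<Sum>T\<in>Pow C'. if S \<inter> (C \<inter> C') = T \<inter> (C \<inter> C') then
          f S * (M (card (S - C')) (card (T - C)) * prod val T) else 0)"
    proof (rule sum.cong[OF refl])
      fix T assume T: "T \<in> Pow C'"
      have "S \<inter> (C - C') = S - C'" "T \<inter> (C' - C) = T - C" using S T by auto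
      then show "m S T * f S * prod val T = (if S \<inter> (C \<inter> C') = T \<inter> (C \<inter> C') then
          f S * (M (card (S - C')) (card (T - C)) * prod val T) else 0)"
        unfolding m M_def by auto
    qed
    also have "\<dots> = (\<Sum>V\<in>Pow (C' - C). f S * (M (card (S - C'))
        (card (S \<inter> (C \<inter> C') \<union> V - C)) * prod val (S \<inter> (C \<inter> C') \<union> V)))"
      by (rule sum_Pow_Int_eq) (use fin in auto)
    also have "\<dots> = (\<Sum>V\<in>Pow (C' - C). f S * prod val (S \<inter> C') *
        (M (card (S - C')) (card V) * prod val V))"
    proof (rule sum.cong[OF refl])
      fix V assume V: "V \<in> Pow (C' - C)"
      have "S \<inter> (C \<inter> C') \<union> V - C = V" "S \<inter> (C \<inter> C') = S \<inter> C'" using S V by auto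
      moreover have "prod val (S \<inter> C' \<union> V) = prod val (S \<inter> C') * prod val V"
        using V S fin finS by (intro prod.union_disjoint) (auto intro: finite_subset)
      ultimately show "f S * (M (card (S - C'))
        (card (S \<inter> (C \<inter> C') \<union> V - C)) * prod val (S \<inter> (C \<inter> C') \<union> V))
        = f S * prod val (S \<inter> C') * (M (card (S - C')) (card V) * prod val V)"
        by (simp add: algebra_simps)
    qed
    also have "\<dots> = f S * prod val (S \<inter> C') * (edge_weight (v - u) C C' G * prod val (S - C'))"
      using key[of "S - C'"] S by (simp add: sum_distrib_left[symmetric] Diff_mono)
    also have "prod val S = prod val (S \<inter> C') * prod val (S - C')"
      using finS by (metis prod.Int_Diff)
    ultimately show "(\<Sum>T\<in>Pow C'. m S T * f S * prod val T)
        = edge_weight (v - u) C C' G * (f S * prod val S)"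
      by (simp add: algebra_simps)
  qed
  finally show ?thesis
    by (simp add: eval_tensor_def val_def sum_distrib_left)
qed

section \<open>Circles as equivalence classes, and evaluation of chains\<close>

lemma equiv_equiv_closure: "equiv UNIV (equiv_closure r)"
proof (rule equivI)
  show "sym (equiv_closure r)"
    by (intro sym_rtrancl sym_Un_converse)
qed (auto intro: refl_rtrancl trans_rtrancl)

lemma equiv_closure_invariant:
  assumes "(x, y) \<in> equiv_closure r" and "\<And>a b. (a, b) \<in> r \<Longrightarrow> P a \<longleftrightarrow> P b"
  shows "P x \<longleftrightarrow> P y"
  using assms(1) by (induction) (use assms(2) in auto)

lemma equiv_class_eq_iff_closure:
  "equiv_closure r `` {x} = equiv_closure r `` {y} \<longleftrightarrow> (x, y) \<in> equiv_closure r"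
  using eq_equiv_class_iff[OF equiv_equiv_closure UNIV_I UNIV_I, of r x y] by blast

lemma partition_of_quotient:
  assumes "finite E" and r: "r \<subseteq> E \<times> E"
  shows "partition_of (E // equiv_closure r) E"
  unfolding partition_of_def
proof (intro conjI ballI impI)
  let ?Q = "equiv_closure r"
  have sub: "?Q `` {x} \<subseteq> E" if "x \<in> E" for x
  proof
    fix y assume "y \<in> ?Q `` {x}"
    then show "y \<in> E"
      using equiv_closure_invariant[of x y r "\<lambda>a. a \<in> E"] r that by auto
  qed
  show "finite (E // ?Q)"
    using assms(1) by (simp add: quotient_def)
  show "\<Union>(E // ?Q) = E"
    using sub by (auto simp: quotient_def)
  show "{} \<notin> E // ?Q"
    by (auto simp: quotient_def)
  fix c d assume "c \<in> E // ?Q" "d \<in> E // ?Q" "c \<noteq> d"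
  then obtain x y where xy: "c = ?Q `` {x}" "d = ?Q `` {y}"
    by (auto simp: quotient_def)
  show "c \<inter> d = {}"
  proof (rule ccontr)
    assume "c \<inter> d \<noteq> {}"
    then obtain z where z: "(x, z) \<in> ?Q" "(y, z) \<in> ?Q"
      unfolding xy by blast
    then have "c = ?Q `` {z}" "d = ?Q `` {z}"
      unfolding xy equiv_class_eq_iff_closure using z by blast+
    then show False
      using \<open>c \<noteq> d\<close> by simp
  qed
qed

definition arcs :: "diagram \<Rightarrow> nat set \<Rightarrow> (nat \<times> nat) set" where
  "arcs D s = (\<Union>i<length (crossings D). resolution (crossings D ! i) (i \<in> s))"

definition eval_chain ::
  "diagram \<Rightarrow> 'r::comm_ring_1 \<Rightarrow> 'r \<Rightarrow> 'r chain \<Rightarrow> nat set \<Rightarrow> nat set \<Rightarrow> 'r" where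
  "eval_chain D u v x s G = eval_tensor u v (circles D s) (\<lambda>T. x (s, T)) G"

lemma eval_chain_add:
  "eval_chain D u v (\<lambda>e. x e + y e) s G = eval_chain D u v x s G + eval_chain D u v y s G"
  by (simp add: eval_chain_def eval_tensor_def distrib_right sum.distrib)

lemma eval_chain_diff:
  "eval_chain D u v (\<lambda>e. x e - y e) s G = eval_chain D u v x s G - eval_chain D u v y s G"
  by (simp add: eval_chain_def eval_tensor_def left_diff_distrib sum_subtractf)

lemma eval_chain_scale:
  "eval_chain D u v (\<lambda>e. c * x e) s G = c * eval_chain D u v x s G"
  by (simp add: eval_chain_def eval_tensor_def sum_distrib_left mult.assoc)

lemma eval_chain_zero: "eval_chain D u v (\<lambda>e. 0) s G = 0"
  by (simp add: eval_chain_def eval_tensor_def)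

lemma differential_in_chains: "differential D p q x \<in> chains D"
  by (auto simp: differential_def chains_def)

lemma differential_add:
  "differential D p q (\<lambda>e. x e + y e) = (\<lambda>e. differential D p q x e + differential D p q y e)"
  by (rule ext) (auto simp: differential_def distrib_left sum.distrib split: prod.split)

lemma differential_scale:
  "differential D p q (\<lambda>e. c * x e) = (\<lambda>e. c * differential D p q x e)"
  by (rule ext) (auto simp: differential_def sum_distrib_left mult.left_commute split: prod.split)

lemma differential_diff:
  "differential D p q (\<lambda>e. x e - y e) = (\<lambda>e. differential D p q x e - differential D p q y e)"
  using differential_add[of D p q x "\<lambda>e. (- 1) * y e"] differential_scale[of D p q "- 1" y]
  by (simp add: fun_eq_iff)

definition well_formed :: "diagram \<Rightarrow> bool" where
  "well_formed D \<longleftrightarrow> finite (edges D) \<and>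
     (\<forall>c\<in>set (crossings D). bl c \<in> edges D \<and> br c \<in> edges D \<and> tl c \<in> edges D \<and> tr c \<in> edges D)"

lemma arcs_subset: "well_formed D \<Longrightarrow> arcs D s \<subseteq> edges D \<times> edges D"
  by (auto simp: arcs_def well_formed_def resolution_def oriented_arcs_def unoriented_arcs_def
      split: if_splits)

lemma circles_eq: "circles D s = edges D // equiv_closure (arcs D s)"
  by (simp add: circles_def arcs_def)

lemma partition_of_circles: "well_formed D \<Longrightarrow> partition_of (circles D s) (edges D)"
  unfolding circles_eq by (rule partition_of_quotient[OF _ arcs_subset]) (auto simp: well_formed_def)

text \<open>The arcs generate the circles, so compatibility becomes a local condition at the
  crossings.\<close>

lemma compatible_circles_iff:
  assumes "well_formed D"
  shows "compatible (circles D s) G \<longleftrightarrow> (\<forall>(e, f)\<in>arcs D s. e \<in> G \<longleftrightarrow> f \<in> G)"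
proof
  assume G: "compatible (circles D s) G"
  show "\<forall>(e, f)\<in>arcs D s. e \<in> G \<longleftrightarrow> f \<in> G"
  proof clarify
    fix e f assume ef: "(e, f) \<in> arcs D s"
    define c where "c = equiv_closure (arcs D s) `` {e}"
    have "c \<in> circles D s"
      using ef arcs_subset[OF assms, of s] by (auto simp: circles_eq quotient_def c_def)
    moreover have "e \<in> c" "f \<in> c"
      using ef by (auto simp: c_def)
    ultimately show "e \<in> G \<longleftrightarrow> f \<in> G"
      using G by (auto simp: compatible_def)
  qed
next
  assume *: "\<forall>(e, f)\<in>arcs D s. e \<in> G \<longleftrightarrow> f \<in> G"
  show "compatible (circles D s) G"
    unfolding compatible_def
  proof
    fix c assume "c \<in> circles D s"
    then obtain e where e: "c = equiv_closure (arcs D s) `` {e}"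
      by (auto simp: circles_eq quotient_def)
    have "f \<in> G \<longleftrightarrow> e \<in> G" if "f \<in> c" for f
      using equiv_closure_invariant[of e f "arcs D s" "\<lambda>e. e \<in> G"] * that e by auto
    then show "c \<subseteq> G \<or> c \<inter> G = {}"
      by blast
  qed
qed

lemma finite_state: "s \<in> states D \<Longrightarrow> finite s"
  by (auto simp: states_def intro: finite_subset)

lemma finite_enhanced_states:
  assumes "well_formed D"
  shows "finite (enhanced_states D)"
  using partition_of_circles[OF assms]
  by (auto simp: enhanced_states_def states_def partition_of_def)

lemma differential_apply:
  assumes "s \<in> states D" "T \<subseteq> circles D s"
  shows "differential D p q x (s, T) = (\<Sum>j\<in>s. (- 1) ^ card {i\<in>s. i < j} *
    (\<Sum>S\<in>Pow (circles D (s - {j})). edge_coeff D p q (s - {j}) j S T * x (s - {j}, S)))"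
  using assms by (simp add: differential_def enhanced_states_def)

lemma eval_tensor_sum:
  "eval_tensor u v C (\<lambda>T. \<Sum>j\<in>J. c j * f j T) G = (\<Sum>j\<in>J. c j * eval_tensor u v C (f j) G)"
  unfolding eval_tensor_def sum_distrib_left sum_distrib_right
  by (subst sum.swap) (simp add: mult.assoc)

text \<open>\<open>G\<close> need not be compatible with the source \<open>s - {j}\<close>; by
  \<open>edge_weight_compatible\<close> the weight is 0 in that case.\<close>

lemma eval_chain_differential:
  fixes u v :: "'r::comm_ring_1"
  assumes D: "well_formed D" and s: "s \<in> states D" and G: "compatible (circles D s) G"
    and p: "p = u + v" and q: "q = - (u * v)"
  shows "eval_chain D u v (differential D p q x) s G =
    (\<Sum>j\<in>s. (- 1) ^ card {i\<in>s. i < j} *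
       (edge_weight (v - u) (circles D (s - {j})) (circles D s) G * eval_chain D u v x (s - {j}) G))"
proof -
  have "eval_chain D u v (differential D p q x) s G = eval_tensor u v (circles D s)
    (\<lambda>T. \<Sum>j\<in>s. (- 1) ^ card {i\<in>s. i < j} *
    (\<Sum>S\<in>Pow (circles D (s - {j})). edge_coeff D p q (s - {j}) j S T * x (s - {j}, S))) G"
    unfolding eval_chain_def eval_tensor_def
    by (intro sum.cong refl) (simp add: differential_apply[OF s])
  also have "\<dots> = (\<Sum>j\<in>s. (- 1) ^ card {i\<in>s. i < j} *
    eval_tensor u v (circles D s) (\<lambda>T. \<Sum>S\<in>Pow (circles D (s - {j})).
      edge_coeff D p q (s - {j}) j S T * x (s - {j}, S)) G)"
    by (rule eval_tensor_sum)
  also have "\<dots> = (\<Sum>j\<in>s. (- 1) ^ card {i\<in>s. i < j} *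
       (edge_weight (v - u) (circles D (s - {j})) (circles D s) G * eval_chain D u v x (s - {j}) G))"
  proof (intro sum.cong refl arg_cong2[of _ _ _ _ "(*)"])
    fix j assume "j \<in> s"
    then have j: "insert j (s - {j}) = s" by auto
    show "eval_tensor u v (circles D s) (\<lambda>T. \<Sum>S\<in>Pow (circles D (s - {j})).
        edge_coeff D p q (s - {j}) j S T * x (s - {j}, S)) G
      = edge_weight (v - u) (circles D (s - {j})) (circles D s) G * eval_chain D u v x (s - {j}) G"
      unfolding eval_chain_def
      by (rule eval_tensor_edge[OF partition_of_circles[OF D] partition_of_circles[OF D] G])
        (simp only: edge_coeff_def Let_def j p q)
  qed
  finally show ?thesis .
qed

text \<open>The form in which injectivity of the evaluation is applied to identities of
  chains.\<close>

lemma chain_eqI: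
  fixes u v :: "'r::idom"
  assumes D: "well_formed D" and "u \<noteq> v" and xy: "x \<in> chains D" "y \<in> chains D"
    and eq: "\<And>s G. s \<in> states D \<Longrightarrow> compatible (circles D s) G \<Longrightarrow>
      eval_chain D u v x s G = eval_chain D u v y s G"
  shows "x = y"
proof
  fix e :: enhanced_state
  obtain s T where e: "e = (s, T)" by (cases e)
  show "x e = y e"
  proof (cases "s \<in> states D \<and> T \<subseteq> circles D s")
    case True
    then show ?thesis
      using eval_tensor_inj[OF partition_of_circles[OF D, of s] \<open>u \<noteq> v\<close>,
          of "\<lambda>T. x (s, T)" "\<lambda>T. y (s, T)" T] eq[of s]
      by (simp add: e eval_chain_def)
  next
    case False
    then have "e \<notin> enhanced_states D" by (auto simp: e enhanced_states_def)
    then show ?thesis using xy unfolding chains_def by (metis (mono_tags, lifting) mem_Collect_eq)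
  qed
qed

section \<open>The checkerboard coloring\<close>

text \<open>Used for the bottom and for the top ends: an edge enters at most one crossing and leaves
  at most one, each time at a single place.\<close>

lemma distinct_concat_pairs:
  assumes "distinct (concat (map (\<lambda>c. [f c, g c]) cs))"
  shows "i < length cs \<Longrightarrow> f (cs ! i) \<noteq> g (cs ! i)"
    and "i < length cs \<Longrightarrow> k < length cs \<Longrightarrow> e \<in> {f (cs ! i), g (cs ! i)} \<Longrightarrow>
      e \<in> {f (cs ! k), g (cs ! k)} \<Longrightarrow> i = k"
  using assms
proof (induction cs arbitrary: i k)
  case (Cons c cs)
  {
    case 1
    then show ?case using Cons.IH(1) by (cases i) auto
  next
    case 2
    have *: "h (cs ! m) \<in> set (concat (map (\<lambda>c. [f c, g c]) cs))"
      if "m < length cs" "h = f \<or> h = g" for m h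
      using that by (auto intro!: bexI[of _ "cs ! m"])
    show ?case
      using 2 Cons.IH(2)[of "i - 1" "k - 1"] *[of "i - 1" f] *[of "i - 1" g]
        *[of "k - 1" f] *[of "k - 1" g]
      by (cases i; cases k) auto
  }
qed auto

lemma knot_diagram_well_formed:
  assumes "knot_diagram D"
  shows "well_formed D"
proof -
  have "set (in_edges D) \<subseteq> edges D" "set (out_edges D) \<subseteq> edges D"
    using assms by (auto simp: knot_diagram_def)
  moreover have "finite (edges D)"
    using assms by (simp add: knot_diagram_def)
  ultimately show ?thesis
    by (auto simp: well_formed_def in_edges_def out_edges_def)
qed

text \<open>This colors the faces of the diagram itself. The channels opened by the Seifert
  smoothing impose nothing new, since the top and bottom faces of a crossing agree in color
  anyway.\<close>

definition checkerboard :: "diagram \<Rightarrow> (side \<Rightarrow> bool) \<Rightarrow> bool" where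
  "checkerboard D f \<longleftrightarrow> (\<forall>e\<in>edges D. f (e, Lft) \<noteq> f (e, Rgt)) \<and>
     (\<forall>c\<in>set (crossings D). \<forall>(x, y)\<in>corners c. f x = f y)"

definition corner_rel :: "diagram \<Rightarrow> (side \<times> side) set" where
  "corner_rel D = (\<Union>c\<in>set (crossings D). corners c)"

text \<open>
  Modulo 2, an edge set is the coboundary of a set of faces iff its coboundary at the crossings
  vanishes: by Euler's formula both sides have \<open>2 ^ (n + 1)\<close> elements.  The set of all edges is of
  this kind.
\<close>

definition crossing_parity :: "diagram \<Rightarrow> nat set \<Rightarrow> nat set" where
  "crossing_parity D g = {i. i < length (crossings D) \<and>
     (let c = crossings D ! i in ((bl c \<in> g) \<noteq> (br c \<in> g)) \<noteq> ((tl c \<in> g) \<noteq> (tr c \<in> g)))}"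

lemma crossing_parity_sym_diff:
  "crossing_parity D (sym_diff g h) = sym_diff (crossing_parity D g) (crossing_parity D h)"
  by (auto simp: crossing_parity_def Let_def)

text \<open>An edge that leaves crossing \<open>m\<close> and enters crossing \<open>k\<close> has
  parity \<open>sym_diff {m} {k}\<close>; along a path of strands these contributions
  telescope.\<close>

lemma crossing_parity_path:
  assumes K: "knot_diagram D" and path: "(e, f) \<in> (strands D)\<^sup>*"
    and i: "i < length (crossings D)" "e \<in> {bl (crossings D ! i), br (crossings D ! i)}"
    and k: "k < length (crossings D)" "f \<in> {bl (crossings D ! k), br (crossings D ! k)}"
  shows "\<exists>g\<subseteq>edges D. crossing_parity D g = sym_diff {i} {k}"
proof -
  have ind: "distinct (concat (map (\<lambda>c. [bl c, br c]) (crossings D)))"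
    and outd: "distinct (concat (map (\<lambda>c. [tl c, tr c]) (crossings D)))"
    using K by (auto simp: knot_diagram_def in_edges_def out_edges_def)
  note in1 = distinct_concat_pairs(1)[OF ind] and in2 = distinct_concat_pairs(2)[OF ind]
    and out1 = distinct_concat_pairs(1)[OF outd] and out2 = distinct_concat_pairs(2)[OF outd]
  show ?thesis
    using path k
  proof (induction arbitrary: k)
    case base
    then have "i = k" using in2 i by blast
    then show ?case
      by (intro exI[of _ "{}"]) (auto simp: crossing_parity_def)
  next
    case (step f f')
    from step.hyps(2) obtain c where "c \<in> set (crossings D)"
      and "(f, f') = (bl c, tr c) \<or> (f, f') = (br c, tl c)"
      by (auto simp: strands_def)
    then obtain m where m: "m < length (crossings D)" "c = crossings D ! m"
      "f \<in> {bl c, br c}" "f' \<in> {tl c, tr c}"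
      by (metis in_set_conv_nth insertI1 insertI2 prod.inject)
    with step.IH[of m] obtain g where g: "g \<subseteq> edges D" "crossing_parity D g = sym_diff {i} {m}"
      by auto
    have "crossing_parity D {f'} = sym_diff {m} {k}"
    proof (rule set_eqI)
      fix j
      show "j \<in> crossing_parity D {f'} \<longleftrightarrow> j \<in> sym_diff {m} {k}"
      proof (cases "j < length (crossings D)")
        case True
        have "((bl (crossings D ! j) = f') \<noteq> (br (crossings D ! j) = f')) \<longleftrightarrow> j = k"
          using in1[OF True] in2[OF True step.prems(1), of f'] step.prems(2) by auto
        moreover have "((tl (crossings D ! j) = f') \<noteq> (tr (crossings D ! j) = f')) \<longleftrightarrow> j = m"
          using out1[OF True] out2[OF True m(1), of f'] m by auto
        ultimately show ?thesis
          using True by (auto simp: crossing_parity_def Let_def)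
      qed (use m step.prems in \<open>auto simp: crossing_parity_def\<close>)
    qed
    then have "crossing_parity D (sym_diff g {f'}) = sym_diff {i} {k}"
      unfolding crossing_parity_sym_diff using g by auto
    moreover have "f' \<in> edges D"
      using knot_diagram_well_formed[OF K] m unfolding well_formed_def by (metis empty_iff insert_iff nth_mem)
    ultimately show ?case
      using g by (intro exI[of _ "sym_diff g {f'}"]) auto
  qed
qed

text \<open>A strand path from an edge to the bottom of a crossing is either trivial or starts by
  entering a crossing. This gives the edge count \<open>2 * n\<close>.\<close>

lemma edges_eq_in_edges:
  assumes K: "knot_diagram D" and "crossings D \<noteq> []"
  shows "edges D = set (in_edges D)"
proof
  show "set (in_edges D) \<subseteq> edges D"
    using K unfolding knot_diagram_def by blast
  obtain c where c: "c \<in> set (crossings D)"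
    using assms(2) by (cases "crossings D") auto
  then have b: "bl c \<in> edges D" "bl c \<in> set (in_edges D)"
    using K knot_diagram_well_formed[OF K] by (auto simp: well_formed_def in_edges_def)
  show "edges D \<subseteq> set (in_edges D)"
  proof
    fix e assume "e \<in> edges D"
    then have "(e, bl c) \<in> (strands D)\<^sup>*"
      using K b by (auto simp: knot_diagram_def)
    then show "e \<in> set (in_edges D)"
      using b by (cases rule: converse_rtranclE) (auto simp: strands_def in_edges_def)
  qed
qed

text \<open>The sets \<open>sym_diff {0} {k}\<close> are all attained. Crossing 0 is left out
  because parities have even size, so the others determine it.\<close>

lemma crossing_parity_onto:
  assumes K: "knot_diagram D" and "A \<subseteq> {..<length (crossings D)} - {0}"
  shows "\<exists>g\<subseteq>edges D. crossing_parity D g - {0} = A"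
proof -
  have "finite A" using assms(2) finite_subset by blast
  then show ?thesis
    using assms(2)
  proof (induction A)
    case empty
    show ?case by (intro exI[of _ "{}"]) (auto simp: crossing_parity_def)
  next
    case (insert k A)
    then obtain g where g: "g \<subseteq> edges D" "crossing_parity D g - {0} = A" by auto
    have k: "k < length (crossings D)" "k \<noteq> 0" using insert.prems by auto
    then have 0: "0 < length (crossings D)" by auto
    have "bl (crossings D ! 0) \<in> edges D" "bl (crossings D ! k) \<in> edges D"
      using knot_diagram_well_formed[OF K] k 0 by (auto simp: well_formed_def)
    then have "(bl (crossings D ! 0), bl (crossings D ! k)) \<in> (strands D)\<^sup>*"
      using K by (auto simp: knot_diagram_def)
    from crossing_parity_path[OF K this 0 _ k(1)]
    obtain h where h: "h \<subseteq> edges D" "crossing_parity D h = sym_diff {0} {k}" by auto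
    have "crossing_parity D (sym_diff g h) - {0} = insert k A"
      unfolding crossing_parity_sym_diff h using g insert.hyps k by auto
    then show ?case
      using g h by (intro exI[of _ "sym_diff g h"]) auto
  qed
qed

text \<open>The bound from rank and nullity: translating the kernel by preimages \<open>h A\<close>
  of the \<open>2 ^ (n - 1)\<close> parities away from crossing 0 gives disjoint families among the
  \<open>2 ^ (2 * n)\<close> edge sets.\<close>

lemma card_crossing_parity_kernel:
  assumes K: "knot_diagram D"
  shows "card {g. g \<subseteq> edges D \<and> crossing_parity D g = {}} \<le> 2 ^ (length (crossings D) + 1)"
proof (cases "crossings D = []")
  case True
  \<comment> \<open>Without crossings there are no strands, so connectedness leaves a single
    edge.\<close>
  then have "card (edges D) \<le> 1"
    using K by (auto simp: knot_diagram_def strands_def card_le_Suc0_iff_eq)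
  moreover have "finite (edges D)" using K by (simp add: knot_diagram_def)
  moreover have "card {g. g \<subseteq> edges D \<and> crossing_parity D g = {}} \<le> card (Pow (edges D))"
    using \<open>finite (edges D)\<close> by (intro card_mono) auto
  moreover have "(2::nat) ^ card (edges D) \<le> 2 ^ 1"
    using \<open>card (edges D) \<le> 1\<close> by (intro power_increasing) auto
  ultimately have "card {g. g \<subseteq> edges D \<and> crossing_parity D g = {}} \<le> 2 ^ 1"
    by (simp add: card_Pow)
  then show ?thesis using True by simp
next
  case False
  define n where "n = length (crossings D)"
  define Z where "Z = {g. g \<subseteq> edges D \<and> crossing_parity D g = {}}"
  define h where "h A = (SOME g. g \<subseteq> edges D \<and> crossing_parity D g - {0} = A)" for A
  have fin: "finite (edges D)" using K by (simp add: knot_diagram_def)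
  have h: "h A \<subseteq> edges D" "crossing_parity D (h A) - {0} = A" if "A \<in> Pow ({..<n} - {0})" for A
    using someI_ex[OF crossing_parity_onto[OF K, of A]] that by (auto simp: h_def n_def)
  have n: "n > 0" using False by (simp add: n_def)
  have len: "length (in_edges D) = 2 * n"
    by (simp add: in_edges_def n_def length_concat comp_def sum_list_triv)
  have "distinct (in_edges D)" using K by (simp add: knot_diagram_def)
  then have cE: "card (edges D) = 2 * n"
    using edges_eq_in_edges[OF K False] len distinct_card by metis
  have "inj_on (\<lambda>(z, A). sym_diff z (h A)) (Z \<times> Pow ({..<n} - {0}))"
  proof (rule inj_onI, clarify)
    fix z A z' A'
    assume z: "z \<in> Z" "z' \<in> Z" and A: "A \<subseteq> {..<n} - {0}" "A' \<subseteq> {..<n} - {0}"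
      and eq: "sym_diff z (h A) = sym_diff z' (h A')"
    have "crossing_parity D (sym_diff z (h A)) - {0} = A"
      "crossing_parity D (sym_diff z' (h A')) - {0} = A'"
      using z A h(2) by (auto simp: crossing_parity_sym_diff Z_def)
    then have "A = A'" using eq by simp
    moreover have "z = sym_diff (sym_diff z (h A)) (h A)" by auto
    moreover have "z' = sym_diff (sym_diff z' (h A)) (h A)" by auto
    ultimately show "z = z' \<and> A = A'" using eq by metis
  qed
  moreover have "(\<lambda>(z, A). sym_diff z (h A)) ` (Z \<times> Pow ({..<n} - {0})) \<subseteq> Pow (edges D)"
    using h(1) by (auto simp: Z_def; blast)
  ultimately have "card (Z \<times> Pow ({..<n} - {0})) \<le> card (Pow (edges D))"
    using fin by (intro card_inj_on_le) auto
  then have "card Z * 2 ^ (n - 1) \<le> 2 ^ (2 * n)"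
    using n fin by (simp add: card_cartesian_product card_Pow cE)
  also have "(2::nat) ^ (2 * n) = 2 ^ (n + 1) * 2 ^ (n - 1)"
    using n by (subst power_add[symmetric]) (simp add: mult_2)
  finally show ?thesis
    by (simp add: Z_def n_def)
qed

lemma strands_invariant:
  assumes conn: "\<forall>e\<in>edges D. \<forall>f\<in>edges D. (e, f) \<in> (strands D)\<^sup>*"
    and step: "\<And>c. c \<in> set (crossings D) \<Longrightarrow> (P (bl c) \<longleftrightarrow> P (tr c)) \<and> (P (br c) \<longleftrightarrow> P (tl c))"
    and "e \<in> edges D" "f \<in> edges D"
  shows "P e \<longleftrightarrow> P f"
proof -
  have "(e, f) \<in> (strands D)\<^sup>*"
    using assms by blast
  then show ?thesis
    by induction (use step in \<open>auto simp: strands_def\<close>)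
qed

lemma corner_relD:
  assumes "c \<in> set (crossings D)"
  shows "((bl c, Lft), (tl c, Lft)) \<in> corner_rel D" "((br c, Rgt), (tr c, Rgt)) \<in> corner_rel D"
    "((tl c, Rgt), (tr c, Lft)) \<in> corner_rel D" "((bl c, Rgt), (br c, Lft)) \<in> corner_rel D"
  using assms by (auto simp: corner_rel_def corners_def)

text \<open>A set of faces and its complement have the same coboundary; excluding the outer face
  removes this ambiguity and makes \<open>cob\<close> injective. The count then makes it onto, and a
  preimage of \<open>edges D\<close> consists of the black faces.\<close>

lemma checkerboard_exists:
  assumes K: "knot_diagram D"
  shows "\<exists>f. checkerboard D f \<and> \<not> f (outer D)"
proof -
  let ?R = "equiv_closure (corner_rel D)"
  define face where "face x = ?R `` {x}" for x
  define n where "n = length (crossings D)"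
  define f0 where "f0 = face (outer D)"
  define cob where "cob A = {e\<in>edges D. (face (e, Lft) \<in> A) \<noteq> (face (e, Rgt) \<in> A)}" for A
  define Z where "Z = {g. g \<subseteq> edges D \<and> crossing_parity D g = {}}"
  have wf: "well_formed D" by (rule knot_diagram_well_formed[OF K])
  have fin: "finite (edges D)" using K by (simp add: knot_diagram_def)
  have faces: "faces D = face ` sides D"
    by (auto simp: faces_def face_def quotient_def corner_rel_def)
  have f0: "f0 \<in> faces D"
    using K by (auto simp: faces f0_def knot_diagram_def)
  have cardF: "card (faces D) = n + 2"
    using K by (simp add: knot_diagram_def n_def)
  then have finF: "finite (faces D)"
    by (metis card.infinite add_2_eq_Suc' nat.distinct(1))
  have face_eq: "face x = face y" if "(x, y) \<in> corner_rel D" for x y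
    using that equiv_class_eq_iff_closure[of "corner_rel D" x y] by (auto simp: face_def)
  have inj: "inj_on cob (Pow (faces D - {f0}))"
  proof (rule inj_onI)
    fix A B assume AB: "A \<in> Pow (faces D - {f0})" "B \<in> Pow (faces D - {f0})" "cob A = cob B"
    \<comment> \<open>\<open>P\<close> says that \<open>A\<close> and \<open>B\<close> agree on the
      face of a side. Equal coboundaries carry it across every edge, connectedness carries it
      everywhere, and it holds at the outer face.\<close>
    define P where "P x \<longleftrightarrow> (face x \<in> A \<longleftrightarrow> face x \<in> B)" for x
    have PLR: "P (e, Lft) \<longleftrightarrow> P (e, Rgt)" if "e \<in> edges D" for e
    proof -
      have "e \<in> cob A \<longleftrightarrow> e \<in> cob B" using AB by simp
      then show ?thesis using that by (auto simp: cob_def P_def)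
    qed
    have Pc: "P x \<longleftrightarrow> P y" if "(x, y) \<in> corner_rel D" for x y
      using face_eq[OF that] by (simp add: P_def)
    have *: "P (e, Lft) \<longleftrightarrow> P (f, Lft)" if "e \<in> edges D" "f \<in> edges D" for e f
    proof (rule strands_invariant[of D "\<lambda>e. P (e, Lft)", OF _ _ that])
      fix c assume c: "c \<in> set (crossings D)"
      then have "bl c \<in> edges D" "tl c \<in> edges D" "br c \<in> edges D" "tr c \<in> edges D"
        using wf by (auto simp: well_formed_def)
      with corner_relD[OF c, THEN Pc] PLR
      show "(P (bl c, Lft) \<longleftrightarrow> P (tr c, Lft)) \<and> (P (br c, Lft) \<longleftrightarrow> P (tl c, Lft))"
        by auto
    qed (use K in \<open>auto simp: knot_diagram_def\<close>)
    have all: "P x \<longleftrightarrow> P y" if "x \<in> sides D" "y \<in> sides D" for x y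
    proof -
      have "P z \<longleftrightarrow> P (fst z, Lft)" if "z \<in> sides D" for z
        using that PLR[of "fst z"] by (cases z; cases "snd z") (simp_all add: sides_def)
      moreover have "fst x \<in> edges D" "fst y \<in> edges D"
        using that by (auto simp: sides_def)
      ultimately show ?thesis
        using that * by blast
    qed
    have "face (outer D) \<notin> A" "face (outer D) \<notin> B"
      using AB unfolding f0_def by auto
    then have "P (outer D)"
      by (simp add: P_def)
    moreover have "outer D \<in> sides D"
      using K by (simp add: knot_diagram_def)
    ultimately have "\<forall>x\<in>sides D. P x"
      using all by blast
    then have "c \<in> A \<longleftrightarrow> c \<in> B" if "c \<in> faces D" for c
      using that unfolding faces P_def by blast
    then show "A = B"
      using AB by blast
  qed
  have "cob A \<in> Z" for A
  proof -
    have "\<not> i \<in> crossing_parity D (cob A)" for i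
    proof
      assume i: "i \<in> crossing_parity D (cob A)"
      then have c: "crossings D ! i \<in> set (crossings D)"
        by (auto simp: crossing_parity_def)
      then have "bl (crossings D ! i) \<in> edges D" "tl (crossings D ! i) \<in> edges D"
        "br (crossings D ! i) \<in> edges D" "tr (crossings D ! i) \<in> edges D"
        using wf by (auto simp: well_formed_def)
      with i corner_relD[OF c, THEN face_eq] show False
        by (auto simp: crossing_parity_def Let_def cob_def)
    qed
    then show ?thesis by (auto simp: Z_def cob_def)
  qed
  then have sub: "cob ` Pow (faces D - {f0}) \<subseteq> Z" by auto
  have finZ: "finite Z"
    by (rule finite_subset[of _ "Pow (edges D)"]) (use fin in \<open>auto simp: Z_def\<close>)
  have "card (cob ` Pow (faces D - {f0})) = 2 ^ (n + 1)"
    using f0 finF cardF by (simp add: card_image[OF inj] card_Pow)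
  then have "cob ` Pow (faces D - {f0}) = Z"
    using card_crossing_parity_kernel[OF K] sub finZ
    by (intro card_seteq) (simp_all add: Z_def n_def)
  \<comment> \<open>All four ends at a crossing count, which is an even number.\<close>
  moreover have "edges D \<in> Z"
    using wf by (auto simp: Z_def crossing_parity_def Let_def well_formed_def)
  ultimately obtain A where A: "A \<subseteq> faces D - {f0}" "cob A = edges D"
    by (metis imageE PowD)
  define f where "f x \<longleftrightarrow> face x \<in> A" for x
  have "f (e, Lft) \<noteq> f (e, Rgt)" if "e \<in> edges D" for e
    using that unfolding A(2)[symmetric] by (auto simp: cob_def f_def)
  moreover have "f x = f y" if "c \<in> set (crossings D)" "(x, y) \<in> corners c" for c x y
  proof -
    have "(x, y) \<in> corner_rel D"
      using that by (auto simp: corner_rel_def)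
    then show ?thesis
      using face_eq by (simp add: f_def)
  qed
  ultimately have "checkerboard D f"
    by (auto simp: checkerboard_def)
  moreover have "\<not> f (outer D)"
    using A by (auto simp: f_def f0_def)
  ultimately show ?thesis by auto
qed

section \<open>The canonical cycles\<close>

text \<open>Going around a crossing, the color changes at each of the four edges, so opposite faces
  agree and one value determines the rest.\<close>

lemma checkerboard_crossing:
  assumes "well_formed D" "checkerboard D f" "c \<in> set (crossings D)"
  shows "f (tl c, Lft) = f (bl c, Lft)" "f (bl c, Rgt) = (\<not> f (bl c, Lft))"
    "f (tl c, Rgt) = (\<not> f (bl c, Lft))" "f (br c, Lft) = (\<not> f (bl c, Lft))"
    "f (tr c, Lft) = (\<not> f (bl c, Lft))" "f (br c, Rgt) = f (bl c, Lft)"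
    "f (tr c, Rgt) = f (bl c, Lft)"
proof -
  have "bl c \<in> edges D" "br c \<in> edges D" "tl c \<in> edges D" "tr c \<in> edges D"
    using assms(1,3) by (auto simp: well_formed_def)
  then have "f (bl c, Lft) \<noteq> f (bl c, Rgt)" "f (br c, Lft) \<noteq> f (br c, Rgt)"
    "f (tl c, Lft) \<noteq> f (tl c, Rgt)" "f (tr c, Lft) \<noteq> f (tr c, Rgt)"
    using assms(2) unfolding checkerboard_def by blast+
  moreover have "f x = f y" if "(x, y) \<in> corners c" for x y
    using assms(2,3) that unfolding checkerboard_def by blast
  then have "f (bl c, Lft) = f (tl c, Lft)" "f (br c, Rgt) = f (tr c, Rgt)"
    "f (tl c, Rgt) = f (tr c, Lft)" "f (bl c, Rgt) = f (br c, Lft)"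
    by (simp_all add: corners_def)
  ultimately show "f (tl c, Lft) = f (bl c, Lft)" "f (bl c, Rgt) = (\<not> f (bl c, Lft))"
    "f (tl c, Rgt) = (\<not> f (bl c, Lft))" "f (br c, Lft) = (\<not> f (bl c, Lft))"
    "f (tr c, Lft) = (\<not> f (bl c, Lft))" "f (br c, Rgt) = f (bl c, Lft)"
    "f (tr c, Rgt) = f (bl c, Lft)"
    by auto
qed

lemma checkerboard_unique:
  assumes wf: "well_formed D" and conn: "\<forall>e\<in>edges D. \<forall>f\<in>edges D. (e, f) \<in> (strands D)\<^sup>*"
    and f: "checkerboard D f" "\<not> f (outer D)" and g: "checkerboard D g" "\<not> g (outer D)"
    and outer: "outer D \<in> sides D" and x: "x \<in> sides D"
  shows "f x = g x"
proof -
  define P where "P e \<longleftrightarrow> f (e, Lft) = g (e, Lft)" for e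
  have PR: "P e \<longleftrightarrow> f (e, h) = g (e, h)" if "e \<in> edges D" for e h
    using that f(1) g(1) by (cases h) (auto simp: P_def checkerboard_def)
  have P: "P e \<longleftrightarrow> P e'" if "e \<in> edges D" "e' \<in> edges D" for e e'
  proof (rule strands_invariant[OF conn _ that])
    fix c assume c: "c \<in> set (crossings D)"
    show "(P (bl c) \<longleftrightarrow> P (tr c)) \<and> (P (br c) \<longleftrightarrow> P (tl c))"
      unfolding P_def checkerboard_crossing[OF wf f(1) c] checkerboard_crossing[OF wf g(1) c]
      by auto
  qed
  have "P (fst (outer D))"
    using PR[of "fst (outer D)" "snd (outer D)"] outer f(2) g(2) by (auto simp: sides_def)
  moreover have "fst (outer D) \<in> edges D" "fst x \<in> edges D"
    using outer x by (auto simp: sides_def)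
  ultimately have "P (fst x)"
    using P by blast
  then show ?thesis
    using PR[OF \<open>fst x \<in> edges D\<close>, of "snd x"] by simp
qed

text \<open>This replaces the definite description in \<open>black_regions\<close> by any explicit
  checkerboard coloring: \<open>f\<close> descends to the Seifert regions, and every admissible set
  of black regions arises from it.\<close>

lemma black_on_left_iff:
  assumes wf: "well_formed D" and conn: "\<forall>e\<in>edges D. \<forall>f\<in>edges D. (e, f) \<in> (strands D)\<^sup>*"
    and f: "checkerboard D f" "\<not> f (outer D)" and outer: "outer D \<in> sides D" and "c \<subseteq> edges D"
  shows "black_on_left D c \<longleftrightarrow> (\<exists>e\<in>c. f (e, Lft))"
proof -
  have region_eq: "region_of D x = region_of D y \<longleftrightarrow> (x, y) \<in> region_rel D" for x y
    unfolding region_of_def region_rel_def by (rule equiv_class_eq_iff_closure)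
  have inv: "f x \<longleftrightarrow> f y" if "(x, y) \<in> region_rel D" for x y
  proof (rule equiv_closure_invariant[OF that[unfolded region_rel_def]])
    fix x y assume "(x, y) \<in> (\<Union>c\<in>set (crossings D). insert ((bl c, Rgt), tl c, Rgt) (corners c))"
    then obtain c where c: "c \<in> set (crossings D)"
      and "(x, y) = ((bl c, Rgt), (tl c, Rgt)) \<or> (x, y) \<in> corners c" by auto
    then show "f x \<longleftrightarrow> f y"
      using checkerboard_crossing[OF wf f(1) c] by (auto simp: corners_def)
  qed
  define B where "B = region_of D ` {x \<in> sides D. f x}"
  have mem_B: "region_of D x \<in> B \<longleftrightarrow> f x" if "x \<in> sides D" for x
  proof
    assume "region_of D x \<in> B"
    then obtain y where "region_of D x = region_of D y" "f y"
      by (auto simp only: B_def)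
    then show "f x"
      using inv[of x y] region_eq by blast
  qed (use that in \<open>auto simp: B_def\<close>)
  have "is_black_regions D B"
    unfolding is_black_regions_def
  proof (intro conjI ballI)
    show "B \<subseteq> seifert_regions D"
      by (auto simp: B_def seifert_regions_def quotient_def region_of_def)
    show "region_of D (outer D) \<notin> B"
      using mem_B[OF outer] f by simp
    fix e assume "e \<in> edges D"
    then show "region_of D (e, Lft) \<in> B \<longleftrightarrow> region_of D (e, Rgt) \<notin> B"
      using mem_B f(1) by (auto simp: sides_def checkerboard_def)
  qed
  moreover have "B' = B" if B': "is_black_regions D B'" for B'
  proof -
    \<comment> \<open>A competing set of black regions pulls back to a checkerboard coloring, which
      \<open>checkerboard_unique\<close> identifies with \<open>f\<close>.\<close>
    define g where "g x \<longleftrightarrow> region_of D x \<in> B'" for x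
    have "checkerboard D g"
      unfolding checkerboard_def
    proof (intro conjI ballI)
      fix e assume "e \<in> edges D"
      then show "g (e, Lft) \<noteq> g (e, Rgt)"
        using B' by (auto simp: g_def is_black_regions_def)
    next
      fix c xy assume "c \<in> set (crossings D)" "xy \<in> corners c"
      then have "xy \<in> region_rel D"
        unfolding region_rel_def by (intro r_into_rtrancl) auto
      then have "region_of D (fst xy) = region_of D (snd xy)"
        unfolding region_eq by simp
      then show "case xy of (x, y) \<Rightarrow> g x = g y"
        by (simp add: g_def case_prod_beta)
    qed
    moreover have "\<not> g (outer D)"
      using B' by (simp add: g_def is_black_regions_def)
    ultimately have fg: "f x = g x" if "x \<in> sides D" for x
      using checkerboard_unique[OF wf conn f _ _ outer that] by blast
    have "r \<in> B' \<longleftrightarrow> r \<in> B" if "r \<in> seifert_regions D" for r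
    proof -
      have "r \<in> region_of D ` sides D"
        using that by (auto simp: seifert_regions_def quotient_def region_of_def)
      then obtain x where x: "r = region_of D x" "x \<in> sides D"
        by (rule imageE)
      show ?thesis
        unfolding x(1) mem_B[OF x(2)] fg[OF x(2)] g_def by (rule refl)
    qed
    moreover have "B \<subseteq> seifert_regions D" "B' \<subseteq> seifert_regions D"
      using \<open>is_black_regions D B\<close> B' by (auto simp: is_black_regions_def)
    ultimately show ?thesis by blast
  qed
  ultimately have "black_regions D = B"
    unfolding black_regions_def by (rule the_equality)
  then show ?thesis
    using mem_B \<open>c \<subseteq> edges D\<close> by (auto simp: black_on_left_def sides_def)
qed

section \<open>Reversal of the orientation and the coloring of the Seifert circles\<close>

lemma reverse_diagram_simps [simp]:
  "edges (reverse_diagram D) = edges D"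
  "crossings (reverse_diagram D) = map reverse_crossing (crossings D)"
  "outer (reverse_diagram D) = (fst (outer D), opposite (snd (outer D)))"
  by (simp_all add: reverse_diagram_def)

lemma reverse_crossing_simps [simp]:
  "positive (reverse_crossing c) = positive c"
  "bl (reverse_crossing c) = tr c" "br (reverse_crossing c) = tl c"
  "tl (reverse_crossing c) = br c" "tr (reverse_crossing c) = bl c"
  by (simp_all add: reverse_crossing_def)

lemma well_formed_reverse: "well_formed D \<Longrightarrow> well_formed (reverse_diagram D)"
  by (auto simp: well_formed_def)

lemma strands_reverse: "strands (reverse_diagram D) = (strands D)\<inverse>"
  by (auto simp: strands_def)

text \<open>The coloring of the plane is unchanged; only the names of the two sides of each edge are
  exchanged.\<close>

lemma checkerboard_reverse:
  assumes "well_formed D" "checkerboard D f"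
  shows "checkerboard (reverse_diagram D) (\<lambda>(e, h). f (e, opposite h))"
  unfolding checkerboard_def
proof (intro conjI ballI)
  fix e assume "e \<in> edges (reverse_diagram D)"
  then show "(case (e, Lft) of (e, h) \<Rightarrow> f (e, opposite h)) \<noteq>
      (case (e, Rgt) of (e, h) \<Rightarrow> f (e, opposite h))"
    using assms(2) by (auto simp: checkerboard_def)
next
  fix c xy assume "c \<in> set (crossings (reverse_diagram D))" and xy: "xy \<in> corners c"
  then obtain c' where c': "c = reverse_crossing c'" "c' \<in> set (crossings D)"
    by auto
  show "case xy of (x, y) \<Rightarrow> (case x of (e, h) \<Rightarrow> f (e, opposite h)) =
      (case y of (e, h) \<Rightarrow> f (e, opposite h))"
    using xy checkerboard_crossing[OF assms c'(2)] by (auto simp: corners_def c')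
qed

lemma arcs_reverse: "arcs (reverse_diagram D) s = (arcs D s)\<inverse>"
proof -
  have "resolution (reverse_crossing c) b = (resolution c b)\<inverse>" for c b
    by (auto simp: resolution_def oriented_arcs_def unoriented_arcs_def)
  then show ?thesis
    by (simp add: arcs_def converse_UNION)
qed

lemma circles_reverse: "circles (reverse_diagram D) s = circles D s"
  by (simp add: circles_eq arcs_reverse Un_commute)

lemma oriented_state_reverse: "oriented_state (reverse_diagram D) = oriented_state D"
  by (auto simp: oriented_state_def)

lemma oriented_state_in_states: "oriented_state D \<in> states D"
  by (auto simp: oriented_state_def states_def)

lemma compatible_subset_iff:
  assumes "compatible C G" "c \<in> C" "e \<in> c"
  shows "c \<subseteq> G \<longleftrightarrow> e \<in> G"
  using assms by (auto simp: compatible_def)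

lemma arcs_crossing:
  assumes "i < length (crossings D)"
  shows "(i \<in> s) = positive (crossings D ! i) \<Longrightarrow>
      (bl (crossings D ! i), br (crossings D ! i)) \<in> arcs D s"
  using assms by (auto simp: arcs_def resolution_def unoriented_arcs_def)

text \<open>\<open>G\<close> collects the edges with black on their left. The middle clause is the
  decisive property of the canonical colors: the two arcs of an oriented smoothing are colored
  differently.\<close>

definition seifert_coloring :: "diagram \<Rightarrow> nat set \<Rightarrow> bool" where
  "seifert_coloring D G \<longleftrightarrow> compatible (seifert_circles D) G \<and>
     (\<forall>c\<in>set (crossings D). (bl c \<in> G) \<noteq> (br c \<in> G)) \<and>
     (\<forall>c\<in>seifert_circles D. (black_on_left D c \<longleftrightarrow> c \<subseteq> G) \<and>
        (black_on_left (reverse_diagram D) c \<longleftrightarrow> \<not> c \<subseteq> G))"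

lemma seifert_coloring_exists:
  assumes K: "knot_diagram D"
  shows "\<exists>G. seifert_coloring D G"
proof -
  obtain f where f: "checkerboard D f" "\<not> f (outer D)"
    using checkerboard_exists[OF K] by auto
  have wf: "well_formed D" by (rule knot_diagram_well_formed[OF K])
  have conn: "\<forall>e\<in>edges D. \<forall>f\<in>edges D. (e, f) \<in> (strands D)\<^sup>*"
    and outer: "outer D \<in> sides D"
    using K by (auto simp: knot_diagram_def)
  define G where "G = {e \<in> edges D. f (e, Lft)}"
  have part: "partition_of (seifert_circles D) (edges D)"
    by (rule partition_of_circles[OF wf])
  have comp: "compatible (seifert_circles D) G"
    unfolding compatible_circles_iff[OF wf]
  proof clarify
    fix e e' assume "(e, e') \<in> arcs D (oriented_state D)"
    then obtain c where c: "c \<in> set (crossings D)" and "(e, e') \<in> oriented_arcs c"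
      unfolding arcs_def resolution_def oriented_state_def
      by (auto split: if_splits) (metis nth_mem)+
    then show "e \<in> G \<longleftrightarrow> e' \<in> G"
      using checkerboard_crossing[OF wf f(1) c] wf
      by (auto simp: G_def oriented_arcs_def well_formed_def)
  qed
  moreover have "(bl c \<in> G) \<noteq> (br c \<in> G)" if "c \<in> set (crossings D)" for c
    using that checkerboard_crossing[OF wf f(1) that] wf by (auto simp: G_def well_formed_def)
  moreover have "(black_on_left D c \<longleftrightarrow> c \<subseteq> G) \<and>
      (black_on_left (reverse_diagram D) c \<longleftrightarrow> \<not> c \<subseteq> G)" if c: "c \<in> seifert_circles D" for c
  proof -
    have cE: "c \<subseteq> edges D" "c \<noteq> {}"
      using c part by (auto simp: partition_of_def)
    then obtain e where e: "e \<in> c" "e \<in> edges D" by auto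
    have mem: "f (e', Lft) \<longleftrightarrow> e' \<in> G" "f (e', Rgt) \<longleftrightarrow> e' \<notin> G" if "e' \<in> c" for e'
      using that cE f(1) by (auto simp: G_def checkerboard_def)
    have G: "e' \<in> G \<longleftrightarrow> c \<subseteq> G" if "e' \<in> c" for e'
      using compatible_subset_iff[OF comp c that] by simp
    have "black_on_left D c \<longleftrightarrow> (\<exists>e\<in>c. f (e, Lft))"
      by (rule black_on_left_iff[OF wf conn f outer cE(1)])
    moreover have "black_on_left (reverse_diagram D) c \<longleftrightarrow>
        (\<exists>e\<in>c. (case (e, Lft) of (e, h) \<Rightarrow> f (e, opposite h)))"
    proof (rule black_on_left_iff[OF well_formed_reverse[OF wf] _ checkerboard_reverse[OF wf f(1)]])
      show "\<forall>e\<in>edges (reverse_diagram D). \<forall>f\<in>edges (reverse_diagram D).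
          (e, f) \<in> (strands (reverse_diagram D))\<^sup>*"
        using conn by (auto simp: strands_reverse rtrancl_converse)
      show "\<not> (case outer (reverse_diagram D) of (e, h) \<Rightarrow> f (e, opposite h))"
        using f(2) by (cases "outer D"; cases "snd (outer D)") auto
      show "outer (reverse_diagram D) \<in> sides (reverse_diagram D)"
        using outer by (auto simp: sides_def)
      show "c \<subseteq> edges (reverse_diagram D)"
        using cE by simp
    qed
    ultimately show ?thesis
      using mem G e by auto
  qed
  ultimately show ?thesis
    unfolding seifert_coloring_def by blast
qed

text \<open>With the factor \<open>X - a\<close> on circles inside \<open>G\<close> and
  \<open>X - b\<close> on the others, both \<alpha> and \<beta> are instances, with \<open>a\<close>
  and \<open>b\<close> exchanged.\<close>

definition canonical_chain :: "diagram \<Rightarrow> nat set \<Rightarrow> 'r::comm_ring_1 \<Rightarrow> 'r \<Rightarrow> 'r chain" where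
  "canonical_chain D G a b = (\<lambda>(s, T). if s = oriented_state D \<and> T \<subseteq> seifert_circles D then
     \<Prod>c\<in>seifert_circles D. if c \<in> T then 1 else if c \<subseteq> G then - a else - b else 0)"

lemma alpha_eq_canonical:
  assumes "seifert_coloring D G"
  shows "alpha a b D = canonical_chain D G a b"
proof -
  have "black_on_left D c \<longleftrightarrow> c \<subseteq> G" if "c \<in> seifert_circles D" for c
    using assms that by (auto simp: seifert_coloring_def)
  then show ?thesis
    unfolding alpha_def canonical_chain_def by (intro ext) (auto intro!: prod.cong)
qed

lemma beta_eq_canonical:
  assumes "seifert_coloring D G"
  shows "beta a b D = canonical_chain D G b a"
proof -
  have "black_on_left (reverse_diagram D) c \<longleftrightarrow> \<not> c \<subseteq> G" if "c \<in> seifert_circles D" for c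
    using assms that by (auto simp: seifert_coloring_def)
  then show ?thesis
    unfolding beta_def alpha_def canonical_chain_def circles_reverse oriented_state_reverse
    by (intro ext) (auto intro!: prod.cong)
qed

lemma canonical_chain_in_chains: "canonical_chain D G a b \<in> chains D"
  using oriented_state_in_states
  by (auto simp: chains_def canonical_chain_def enhanced_states_def)

lemma eval_canonical_chain:
  assumes wf: "well_formed D"
  shows "eval_chain D u v (canonical_chain D G a b) s G' = (if s = oriented_state D then
    \<Prod>c\<in>seifert_circles D. root_at u v G' c - (if c \<subseteq> G then a else b) else 0)"
proof (cases "s = oriented_state D")
  case True
  let ?C = "seifert_circles D"
  have fin: "finite ?C"
    using partition_of_circles[OF wf] by (auto simp: partition_of_def)
  have "(\<Prod>c\<in>?C. root_at u v G' c + (if c \<subseteq> G then - a else - b))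
    = (\<Sum>T\<in>Pow ?C. (\<Prod>c\<in>T. root_at u v G' c) * (\<Prod>c\<in>?C - T. if c \<subseteq> G then - a else - b))"
    by (rule prod_add[OF fin])
  also have "\<dots> = (\<Sum>T\<in>Pow ?C. canonical_chain D G a b (s, T) * (\<Prod>c\<in>T. root_at u v G' c))"
  proof (rule sum.cong[OF refl])
    fix T assume T: "T \<in> Pow ?C"
    have "(\<Prod>c\<in>?C - T. if c \<subseteq> G then - a else - b)
        = (\<Prod>c\<in>?C. if c \<in> T then 1 else if c \<subseteq> G then - a else - b)"
      using fin by (intro prod.mono_neutral_cong_left) auto
    then show "(\<Prod>c\<in>T. root_at u v G' c) * (\<Prod>c\<in>?C - T. if c \<subseteq> G then - a else - b)
        = canonical_chain D G a b (s, T) * (\<Prod>c\<in>T. root_at u v G' c)"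
      using True T by (simp add: canonical_chain_def mult.commute)
  qed
  finally show ?thesis
    using True by (simp add: eval_chain_def eval_tensor_def if_distrib[of "\<lambda>x. _ + x"]
        if_distrib[of "\<lambda>x. _ - x"] cong: if_cong)
next
  case False
  then show ?thesis
    by (simp add: eval_chain_def eval_tensor_def canonical_chain_def)
qed

lemma eval_canonical_chain_nonzero:
  fixes u v :: "'r::idom"
  assumes wf: "well_formed D" and "u \<noteq> v"
  shows "eval_chain D u v (canonical_chain D G u v) (oriented_state D) G \<noteq> 0"
  using \<open>u \<noteq> v\<close> partition_of_circles[OF wf, of "oriented_state D"]
  by (auto simp: eval_canonical_chain[OF wf] root_at_def partition_of_def)

text \<open>Every factor vanishes at \<open>G\<close>; an edge is needed so that the product is not
  empty.\<close>

lemma eval_canonical_chain_opposite: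
  fixes u v :: "'r::idom"
  assumes wf: "well_formed D" and "edges D \<noteq> {}"
  shows "eval_chain D u v (canonical_chain D G v u) (oriented_state D) G = 0"
proof -
  have "finite (seifert_circles D)" "seifert_circles D \<noteq> {}"
    using partition_of_circles[OF wf, of "oriented_state D"] assms(2) by (auto simp: partition_of_def)
  then show ?thesis
    by (auto simp: eval_canonical_chain[OF wf] root_at_def prod_zero_iff)
qed

text \<open>No factor may vanish, so each circle takes the root other than the one subtracted there.
  This leaves \<open>G\<close> for the pair \<open>(u, v)\<close> and its complement for
  \<open>(v, u)\<close>.\<close>

lemma eval_canonical_chain_support:
  fixes u v :: "'r::idom"
  assumes wf: "well_formed D" and G: "seifert_coloring D G" and G': "compatible (seifert_circles D) G'"
    and ab: "(a, b) = (u, v) \<or> (a, b) = (v, u)"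
    and nz: "eval_chain D u v (canonical_chain D G a b) (oriented_state D) G' \<noteq> 0"
    and e: "e \<in> edges D"
  shows "(e \<in> G') = ((e \<in> G) = ((a, b) = (u, v)))"
proof -
  obtain c where c: "c \<in> seifert_circles D" "e \<in> c"
    using e partition_of_circles[OF wf, of "oriented_state D"] unfolding partition_of_def by blast
  have "finite (seifert_circles D)"
    using partition_of_circles[OF wf, of "oriented_state D"] by (auto simp: partition_of_def)
  then have "root_at u v G' c \<noteq> (if c \<subseteq> G then a else b)"
    using nz c by (auto simp: eval_canonical_chain[OF wf])
  moreover have "c \<subseteq> G \<longleftrightarrow> e \<in> G" "c \<subseteq> G' \<longleftrightarrow> e \<in> G'"
    using G by (intro compatible_subset_iff[OF _ c] G'; simp add: seifert_coloring_def)+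
  ultimately show ?thesis
    using ab by (auto simp: root_at_def split: if_splits)
qed

text \<open>An edge leaving the oriented state resmooths a positive crossing and thereby joins its
  two bottom edges. These have different colors in the only coloring at which the chain does not
  vanish.\<close>

lemma canonical_chain_cycle:
  fixes u v :: "'r::idom"
  assumes wf: "well_formed D" and G: "seifert_coloring D G" and "u \<noteq> v"
    and ab: "(a, b) = (u, v) \<or> (a, b) = (v, u)"
    and p: "p = u + v" and q: "q = - (u * v)"
  shows "canonical_chain D G a b \<in> cycles D p q"
proof -
  have "differential D p q (canonical_chain D G a b) = (\<lambda>_. 0)"
  proof (rule chain_eqI[OF wf \<open>u \<noteq> v\<close> differential_in_chains])
    fix s G' assume s: "s \<in> states D" and G': "compatible (circles D s) G'"
    have "edge_weight (v - u) (circles D (s - {j})) (circles D s) G' *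
        eval_chain D u v (canonical_chain D G a b) (s - {j}) G' = 0" if j: "j \<in> s" for j
    proof (rule ccontr)
      assume nz: "\<not> ?thesis"
      then have sj: "s - {j} = oriented_state D"
        by (auto simp: eval_canonical_chain[OF wf] split: if_splits)
      have comp: "compatible (seifert_circles D) G'"
        using edge_weight_compatible[OF partition_of_circles[OF wf] partition_of_circles[OF wf] G',
            of "v - u" "s - {j}"] nz sj by auto
      have jn: "j < length (crossings D)" using j s by (auto simp: states_def)
      let ?c = "crossings D ! j"
      have "j \<notin> oriented_state D" using sj by auto
      then have "positive ?c" using jn by (auto simp: oriented_state_def)
      then have "(bl ?c, br ?c) \<in> arcs D s"
        using arcs_crossing[OF jn, of s] j by simp
      then have "bl ?c \<in> G' \<longleftrightarrow> br ?c \<in> G'"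
        using G' by (auto simp: compatible_circles_iff[OF wf])
      moreover have "bl ?c \<in> edges D" "br ?c \<in> edges D" "(bl ?c \<in> G) \<noteq> (br ?c \<in> G)"
        using wf G jn by (auto simp: well_formed_def seifert_coloring_def)
      moreover have "eval_chain D u v (canonical_chain D G a b) (oriented_state D) G' \<noteq> 0"
        using nz sj by auto
      ultimately show False
        using eval_canonical_chain_support[OF wf G comp ab] by blast
    qed
    then show "eval_chain D u v (differential D p q (canonical_chain D G a b)) s G' =
        eval_chain D u v (\<lambda>_. 0) s G'"
      unfolding eval_chain_differential[OF wf s G' p q] eval_chain_zero
      by (intro sum.neutral ballI) simp
  qed (auto simp: chains_def)
  then show ?thesis
    by (simp add: cycles_def canonical_chain_in_chains)
qed

text \<open>The edges arriving at the oriented state start from an unoriented smoothing of a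
  negative crossing, with which \<open>G\<close> is incompatible. Evaluation at \<open>G\<close>
  hence is a functional on homology that detects classes.\<close>

lemma eval_boundary_seifert:
  fixes u v :: "'r::idom"
  assumes wf: "well_formed D" and G: "seifert_coloring D G"
    and p: "p = u + v" and q: "q = - (u * v)"
    and y: "y \<in> boundaries D p q"
  shows "eval_chain D u v y (oriented_state D) G = 0"
proof -
  obtain z where z: "y = differential D p q z"
    using y by (auto simp: boundaries_def)
  let ?o = "oriented_state D"
  have comp: "compatible (circles D ?o) G"
    using G by (simp add: seifert_coloring_def)
  have "edge_weight (v - u) (circles D (?o - {j})) (circles D ?o) G = 0" if j: "j \<in> ?o" for j
  proof (rule ccontr)
    assume nz: "\<not> ?thesis"
    let ?c = "crossings D ! j"
    have jn: "j < length (crossings D)" "\<not> positive ?c"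
      using j by (auto simp: oriented_state_def)
    have "compatible (circles D (?o - {j})) G"
      using edge_weight_compatible[OF partition_of_circles[OF wf] partition_of_circles[OF wf] comp nz] .
    moreover have "(bl ?c, br ?c) \<in> arcs D (?o - {j})"
      using arcs_crossing[OF jn(1), of "?o - {j}"] jn by simp
    ultimately have "bl ?c \<in> G \<longleftrightarrow> br ?c \<in> G"
      by (auto simp: compatible_circles_iff[OF wf])
    then show False
      using G jn by (auto simp: seifert_coloring_def)
  qed
  then show ?thesis
    unfolding z
    by (simp add: eval_chain_differential[OF wf oriented_state_in_states comp p q])
qed

section \<open>Filtrations and chain maps\<close>

definition filtered :: "diagram \<Rightarrow> int \<Rightarrow> 'r::comm_ring_1 chain \<Rightarrow> bool" where
  "filtered D j x \<longleftrightarrow> (\<forall>e. x e \<noteq> 0 \<longrightarrow> j \<le> qdeg_state D e)"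

text \<open>The statement that the class of \<open>x\<close> has filtration degree at least
  \<open>j\<close>, phrased without minima and maxima so that the zero chain needs no
  exception.\<close>

definition representable :: "diagram \<Rightarrow> 'r::comm_ring_1 \<Rightarrow> 'r \<Rightarrow> 'r chain \<Rightarrow> int \<Rightarrow> bool" where
  "representable D p q x j \<longleftrightarrow> (\<exists>y\<in>homology_class D p q x. filtered D j y)"

lemma representableI:
  assumes "y \<in> chains D" "differential D p q y = (\<lambda>_. 0)" "filtered D j y"
    and "z \<in> chains D" "(\<lambda>e. y e - x e) = differential D p q z"
  shows "representable D p q x j"
  using assms unfolding representable_def homology_class_def cycles_def boundaries_def by blast

lemma representableE:
  assumes "representable D p q x j"
  obtains y z where "y \<in> chains D" "differential D p q y = (\<lambda>_. 0)" "filtered D j y"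
    "z \<in> chains D" "(\<lambda>e. y e - x e) = differential D p q z"
  using assms by (auto simp: representable_def homology_class_def cycles_def boundaries_def)

lemma representable_map:
  assumes diff: "\<And>x y. F (\<lambda>e. x e - y e) = (\<lambda>e. F x e - F y e)"
    and comm: "\<And>x. differential D p' q' (F x) = F (differential D p q x)"
    and chains: "\<And>x. x \<in> chains D \<Longrightarrow> F x \<in> chains D"
    and filt: "\<And>x. filtered D j x \<Longrightarrow> filtered D j' (F x)"
    and rep: "representable D p q x j"
  shows "representable D p' q' (F x) j'"
proof -
  have zero: "F (\<lambda>_. 0) = (\<lambda>_. 0)"
    using diff[of "\<lambda>_. 0" "\<lambda>_. 0"] by simp
  obtain y z where y: "y \<in> chains D" "differential D p q y = (\<lambda>_. 0)" "filtered D j y"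
    and z: "z \<in> chains D" "(\<lambda>e. y e - x e) = differential D p q z"
    using rep by (rule representableE)
  have "(\<lambda>e. F y e - F x e) = differential D p' q' (F z)"
    unfolding comm z(2)[symmetric] by (rule diff[symmetric])
  then show ?thesis
    using y z by (intro representableI[of "F y" _ _ _ _ "F z"]) (simp_all add: comm zero chains filt)
qed

lemma representable_scale:
  fixes x :: "'r::comm_ring_1 chain"
  assumes "representable D p q x j"
  shows "representable D p q (\<lambda>e. c * x e) j"
proof (rule representable_map[OF _ _ _ _ assms])
  fix x :: "'r chain" assume "filtered D j x"
  then show "filtered D j (\<lambda>e. c * x e)"
    unfolding filtered_def by (metis mult_zero_right)
qed (auto simp: differential_scale chains_def right_diff_distrib)

lemma representable_add:
  assumes "representable D p q x j" "representable D p q y j"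
  shows "representable D p q (\<lambda>e. x e + y e) j"
proof -
  obtain x' z where x: "x' \<in> chains D" "differential D p q x' = (\<lambda>_. 0)" "filtered D j x'"
    and z: "z \<in> chains D" "(\<lambda>e. x' e - x e) = differential D p q z"
    using assms(1) by (rule representableE)
  obtain y' w where y: "y' \<in> chains D" "differential D p q y' = (\<lambda>_. 0)" "filtered D j y'"
    and w: "w \<in> chains D" "(\<lambda>e. y' e - y e) = differential D p q w"
    using assms(2) by (rule representableE)
  have "(\<lambda>e. (x' e + y' e) - (x e + y e)) = differential D p q (\<lambda>e. z e + w e)"
    unfolding differential_add z(2)[symmetric] w(2)[symmetric] by auto
  moreover have "filtered D j (\<lambda>e. x' e + y' e)"
    using x(3) y(3) unfolding filtered_def by (metis add_0)
  moreover have "differential D p q (\<lambda>e. x' e + y' e) = (\<lambda>_. 0)"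
    unfolding differential_add x y by simp
  moreover have "(\<lambda>e. x' e + y' e) \<in> chains D" "(\<lambda>e. z e + w e) \<in> chains D"
    using x y z w unfolding chains_def by simp_all
  ultimately show ?thesis
    by (intro representableI)
qed

lemma finite_circles: "well_formed D \<Longrightarrow> finite (circles D s)"
  using partition_of_circles[of D s] by (simp add: partition_of_def)

text \<open>The map of complexes induced by the substitution \<open>X \<mapsto> X + t\<close>.\<close>

definition shift_chain :: "diagram \<Rightarrow> 'r::comm_ring_1 \<Rightarrow> 'r chain \<Rightarrow> 'r chain" where
  "shift_chain D t x = (\<lambda>(s, T). if (s, T) \<in> enhanced_states D then
     \<Sum>S\<in>{S\<in>Pow (circles D s). T \<subseteq> S}. t ^ card (S - T) * x (s, S) else 0)"

text \<open>Expanding the product of the factors \<open>X + t\<close> over subsets and evaluating at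
  a root amounts to evaluating at the shifted root.\<close>

lemma eval_shift_chain:
  fixes u v t :: "'r::comm_ring_1"
  assumes wf: "well_formed D" and s: "s \<in> states D"
  shows "eval_chain D u v (shift_chain D t x) s G = eval_chain D (u + t) (v + t) x s G"
proof -
  let ?C = "circles D s" and ?val = "root_at u v G"
  have fin: "finite ?C"
    using partition_of_circles[OF wf] by (auto simp: partition_of_def)
  have "eval_chain D u v (shift_chain D t x) s G =
      (\<Sum>T\<in>Pow ?C. \<Sum>S\<in>{S\<in>Pow ?C. T \<subseteq> S}. t ^ card (S - T) * x (s, S) * prod ?val T)"
    unfolding eval_chain_def eval_tensor_def using s
    by (intro sum.cong refl) (auto simp: shift_chain_def enhanced_states_def sum_distrib_right)
  also have "\<dots> = (\<Sum>S\<in>Pow ?C. \<Sum>T\<in>{T\<in>Pow ?C. T \<subseteq> S}. t ^ card (S - T) * x (s, S) * prod ?val T)"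
    using fin by (intro sum.swap_restrict) auto
  also have "\<dots> = (\<Sum>S\<in>Pow ?C. x (s, S) * prod (root_at (u + t) (v + t) G) S)"
  proof (rule sum.cong[OF refl])
    fix S assume S: "S \<in> Pow ?C"
    then have "finite S" using fin finite_subset by auto
    have "(\<Sum>T\<in>{T\<in>Pow ?C. T \<subseteq> S}. t ^ card (S - T) * x (s, S) * prod ?val T)
        = x (s, S) * (\<Sum>T\<in>Pow S. prod ?val T * (\<Prod>c\<in>S - T. t))"
      unfolding sum_distrib_left using S by (intro sum.cong) (auto simp: mult_ac)
    also have "(\<Sum>T\<in>Pow S. prod ?val T * (\<Prod>c\<in>S - T. t)) = (\<Prod>c\<in>S. ?val c + t)"
      by (rule prod_add[OF \<open>finite S\<close>, symmetric])
    also have "\<dots> = prod (root_at (u + t) (v + t) G) S"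
      by (intro prod.cong) (auto simp: root_at_def)
    finally show "(\<Sum>T\<in>{T\<in>Pow ?C. T \<subseteq> S}. t ^ card (S - T) * x (s, S) * prod ?val T)
        = x (s, S) * prod (root_at (u + t) (v + t) G) S" .
  qed
  finally show ?thesis by (simp add: eval_chain_def eval_tensor_def)
qed

lemma shift_chain_in_chains: "shift_chain D t x \<in> chains D"
  by (auto simp: shift_chain_def chains_def)

lemma Diff_in_states: "s \<in> states D \<Longrightarrow> s - A \<in> states D"
  by (auto simp: states_def)

text \<open>On evaluations both differentials have the same weights, because the shift does not
  change the difference of the roots.\<close>

lemma differential_shift_chain:
  fixes u v t :: "'r::idom"
  assumes wf: "well_formed D" and "u \<noteq> v"
  shows "differential D (u + v) (- (u * v)) (shift_chain D t x) =
    shift_chain D t (differential D ((u + t) + (v + t)) (- ((u + t) * (v + t))) x)"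
proof (rule chain_eqI[OF wf \<open>u \<noteq> v\<close> differential_in_chains shift_chain_in_chains])
  fix s G assume s: "s \<in> states D" and G: "compatible (circles D s) G"
  show "eval_chain D u v (differential D (u + v) (- (u * v)) (shift_chain D t x)) s G =
    eval_chain D u v (shift_chain D t
      (differential D ((u + t) + (v + t)) (- ((u + t) * (v + t))) x)) s G"
    unfolding eval_shift_chain[OF wf s] eval_chain_differential[OF wf s G refl refl]
      eval_shift_chain[OF wf Diff_in_states[OF s]] by simp
qed

lemma shift_chain_diff:
  "shift_chain D t (\<lambda>e. x e - y e) = (\<lambda>e. shift_chain D t x e - shift_chain D t y e)"
  by (rule ext) (auto simp: shift_chain_def right_diff_distrib sum_subtractf split: prod.split)

text \<open>The shift only replaces some factors \<open>X\<close> by multiples of \<open>1\<close>,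
  which raises the degree.\<close>

lemma filtered_shift_chain:
  assumes wf: "well_formed D" and x: "filtered D j x"
  shows "filtered D j (shift_chain D t x)"
  unfolding filtered_def
proof clarify
  fix s T assume nz: "shift_chain D t x (s, T) \<noteq> 0"
  then have "(\<Sum>S\<in>{S\<in>Pow (circles D s). T \<subseteq> S}. t ^ card (S - T) * x (s, S)) \<noteq> 0"
    by (auto simp: shift_chain_def split: if_splits)
  then obtain S where "S \<in> {S\<in>Pow (circles D s). T \<subseteq> S}" "t ^ card (S - T) * x (s, S) \<noteq> 0"
    by (rule sum.not_neutral_contains_not_neutral)
  then have S: "S \<subseteq> circles D s" "T \<subseteq> S" "x (s, S) \<noteq> 0"
    by auto
  have "finite S"
    using S(1) finite_subset finite_circles[OF wf] by metis
  then have "card T \<le> card S"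
    using S by (intro card_mono)
  moreover have "j \<le> qdeg_state D (s, S)"
    using S(3) x unfolding filtered_def by blast
  ultimately show "j \<le> qdeg_state D (s, T)"
    by (simp add: qdeg_state_def)
qed

lemma representable_shift_chain:
  fixes u v t :: "'r::idom"
  assumes wf: "well_formed D" and "u \<noteq> v"
    and "representable D ((u + t) + (v + t)) (- ((u + t) * (v + t))) x j"
  shows "representable D (u + v) (- (u * v)) (shift_chain D t x) j"
  by (rule representable_map[OF shift_chain_diff differential_shift_chain[OF assms(1,2)]
        shift_chain_in_chains filtered_shift_chain[OF wf] assms(3)])

lemma shift_canonical_chain:
  fixes u v t :: "'r::idom"
  assumes wf: "well_formed D" and "u \<noteq> v"
  shows "shift_chain D t (canonical_chain D G (a + t) (b + t)) = canonical_chain D G a b"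
proof (rule chain_eqI[OF wf \<open>u \<noteq> v\<close> shift_chain_in_chains canonical_chain_in_chains])
  fix s G' assume s: "s \<in> states D"
  have "root_at (u + t) (v + t) G' c - (if c \<subseteq> G then a + t else b + t) =
      root_at u v G' c - (if c \<subseteq> G then a else b)" for c
    by (simp add: root_at_def)
  then show "eval_chain D u v (shift_chain D t (canonical_chain D G (a + t) (b + t))) s G' =
      eval_chain D u v (canonical_chain D G a b) s G'"
    by (simp add: eval_shift_chain[OF wf s] eval_canonical_chain[OF wf])
qed

text \<open>Multiplication by \<open>X\<close> at the circle through the edge \<open>e\<close>, for \<open>X\<^sup>2 = 1\<close>.\<close>

definition circle_at :: "diagram \<Rightarrow> nat set \<Rightarrow> nat \<Rightarrow> nat set" where
  "circle_at D s e = equiv_closure (arcs D s) `` {e}"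

definition mult_X :: "diagram \<Rightarrow> nat \<Rightarrow> 'r::comm_ring_1 chain \<Rightarrow> 'r chain" where
  "mult_X D e x = (\<lambda>(s, T). if (s, T) \<in> enhanced_states D
     then x (s, sym_diff T {circle_at D s e}) else 0)"

lemma sym_diff_cancel: "sym_diff (sym_diff A B) B = A"
  by auto

lemma eval_mult_X:
  fixes x :: "'r::comm_ring_1 chain"
  assumes wf: "well_formed D" and s: "s \<in> states D" and G: "compatible (circles D s) G"
    and e: "e \<in> edges D"
  shows "eval_chain D (- 1) 1 (mult_X D e x) s G =
    (if e \<in> G then 1 else - 1) * eval_chain D (- 1) 1 x s G"
proof -
  let ?C = "circles D s" and ?c = "circle_at D s e" and ?val = "root_at (- 1) (1::'r) G"
  have c: "?c \<in> ?C" "e \<in> ?c"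
    using e by (auto simp: circles_eq circle_at_def quotient_def)
  have fin: "finite ?C"
    using partition_of_circles[OF wf] by (auto simp: partition_of_def)
  have val: "?val ?c = (if e \<in> G then 1 else - 1)"
    using compatible_subset_iff[OF G c] by (simp add: root_at_def)
  have "eval_chain D (- 1) 1 (mult_X D e x) s G
      = (\<Sum>T\<in>Pow ?C. x (s, sym_diff T {?c}) * prod ?val T)"
    unfolding eval_chain_def eval_tensor_def using s
    by (intro sum.cong refl) (auto simp: mult_X_def enhanced_states_def)
  also have "\<dots> = (\<Sum>T\<in>Pow ?C. x (s, T) * prod ?val (sym_diff T {?c}))"
    by (rule sum.reindex_bij_witness[of _ "\<lambda>T. sym_diff T {?c}" "\<lambda>T. sym_diff T {?c}"])
      (use c in \<open>auto simp: sym_diff_cancel\<close>)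
  also have "\<dots> = (\<Sum>T\<in>Pow ?C. ?val ?c * (x (s, T) * prod ?val T))"
  proof (rule sum.cong[OF refl])
    fix T assume "T \<in> Pow ?C"
    then have finT: "finite T" using fin finite_subset by auto
    have "prod ?val (sym_diff T {?c}) = ?val ?c * prod ?val T"
    proof (cases "?c \<in> T")
      case True
      then have "sym_diff T {?c} = T - {?c}" by auto
      moreover have "prod ?val T = ?val ?c * prod ?val (T - {?c})"
        using finT True by (rule prod.remove)
      ultimately show ?thesis by (simp add: val)
    next
      case False
      then have "sym_diff T {?c} = insert ?c T" by auto
      then show ?thesis using False finT by simp
    qed
    then show "x (s, T) * prod ?val (sym_diff T {?c}) = ?val ?c * (x (s, T) * prod ?val T)"
      by (simp add: mult_ac)
  qed
  finally show ?thesis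
    by (simp add: val eval_chain_def eval_tensor_def sum_distrib_left)
qed

lemma mult_X_in_chains: "mult_X D e x \<in> chains D"
  by (auto simp: mult_X_def chains_def)

lemma one_neq_minus_one: "(2::'r::ring_1) \<noteq> 0 \<Longrightarrow> (- 1::'r) \<noteq> 1"
  by (metis add.right_inverse one_add_one)

text \<open>On evaluations the map is a sign that depends on the color of the fixed edge
  \<open>e\<close> alone, hence is the same at both ends of every edge of the cube.\<close>

lemma differential_mult_X:
  fixes x :: "'r::idom chain"
  assumes wf: "well_formed D" and two: "(2::'r) \<noteq> 0" and e: "e \<in> edges D"
  shows "differential D 0 1 (mult_X D e x) = mult_X D e (differential D 0 1 x)"
proof -
  have ne: "(- 1::'r) \<noteq> 1" and p: "(0::'r) = - 1 + 1" and q: "(1::'r) = - ((- 1) * 1)"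
    using one_neq_minus_one[OF two] by simp_all
  show ?thesis
  proof (rule chain_eqI[OF wf ne differential_in_chains mult_X_in_chains])
    fix s G assume s: "s \<in> states D" and G: "compatible (circles D s) G"
    let ?w = "\<lambda>j. edge_weight (1 - - 1 :: 'r) (circles D (s - {j})) (circles D s) G"
    \<comment> \<open>\<open>eval_mult_X\<close> needs \<open>G\<close> to be compatible with the
      source; a nonzero weight guarantees this.\<close>
    have *: "?w j * eval_chain D (- 1) 1 (mult_X D e x) (s - {j}) G =
        (if e \<in> G then 1 else - 1) * (?w j * eval_chain D (- 1) 1 x (s - {j}) G)" for j
    proof (cases "?w j = 0")
      case False
      have comp: "compatible (circles D (s - {j})) G"
        by (rule edge_weight_compatible[OF partition_of_circles[OF wf] partition_of_circles[OF wf]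
              G False])
      show ?thesis
        unfolding eval_mult_X[OF wf Diff_in_states[OF s] comp e]
        by (rule mult.left_commute)
    qed simp
    show "eval_chain D (- 1) 1 (differential D 0 1 (mult_X D e x)) s G =
        eval_chain D (- 1) 1 (mult_X D e (differential D 0 1 x)) s G"
      unfolding eval_mult_X[OF wf s G e] eval_chain_differential[OF wf s G p q] *
      by (simp add: sum_distrib_left mult_ac)
  qed
qed

lemma mult_X_diff: "mult_X D e (\<lambda>z. x z - y z) = (\<lambda>z. mult_X D e x z - mult_X D e y z)"
  by (rule ext) (auto simp: mult_X_def split: prod.split)

lemma filtered_mult_X:
  assumes wf: "well_formed D" and x: "filtered D j x"
  shows "filtered D (j - 2) (mult_X D e x)"
  unfolding filtered_def
proof clarify
  fix s T assume nz: "mult_X D e x (s, T) \<noteq> 0"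
  then have T: "T \<subseteq> circles D s" and nz: "x (s, sym_diff T {circle_at D s e}) \<noteq> 0"
    by (auto simp: mult_X_def enhanced_states_def split: if_splits)
  have "finite T"
    using T finite_subset finite_circles[OF wf] by metis
  then have "card T \<le> card (insert (circle_at D s e) (sym_diff T {circle_at D s e}))"
    by (intro card_mono) auto
  also have "\<dots> \<le> Suc (card (sym_diff T {circle_at D s e}))"
    by (rule card_insert_le_m1) (simp_all)
  finally have "card T \<le> Suc (card (sym_diff T {circle_at D s e}))" .
  moreover have "j \<le> qdeg_state D (s, sym_diff T {circle_at D s e})"
    using nz x by (auto simp: filtered_def)
  ultimately show "j - 2 \<le> qdeg_state D (s, T)"
    by (simp add: qdeg_state_def)
qed

lemma representable_mult_X:
  fixes x :: "'r::idom chain"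
  assumes wf: "well_formed D" and two: "(2::'r) \<noteq> 0" and e: "e \<in> edges D"
    and "representable D 0 1 x j"
  shows "representable D 0 1 (mult_X D e x) (j - 2)"
  by (rule representable_map[OF mult_X_diff differential_mult_X[OF assms(1-3)]
        mult_X_in_chains filtered_mult_X[OF wf] assms(4)])

text \<open>If \<open>a\<close> is 1 or -1 and \<open>X^2 = 1\<close>, then
  \<open>X (X - a) = - a (X - a)\<close>, and \<open>- a = b\<close>.\<close>

lemma mult_X_canonical_chain:
  fixes a b :: "'r::idom"
  assumes wf: "well_formed D" and G: "seifert_coloring D G" and two: "(2::'r) \<noteq> 0"
    and e: "e \<in> edges D" and ab: "(a, b) = (- 1, 1) \<or> (a, b) = (1, - 1)"
  shows "mult_X D e (canonical_chain D G a b) =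
    (\<lambda>z. (if e \<in> G then b else a) * canonical_chain D G a b z)"
proof -
  have ne: "(- 1::'r) \<noteq> 1"
    using one_neq_minus_one[OF two] by simp_all
  show ?thesis
  proof (rule chain_eqI[OF wf ne mult_X_in_chains])
    show "(\<lambda>z. (if e \<in> G then b else a) * canonical_chain D G a b z) \<in> chains D"
      using canonical_chain_in_chains[of D G a b] by (auto simp: chains_def)
    fix s G' assume s: "s \<in> states D" and G': "compatible (circles D s) G'"
    let ?c = "canonical_chain D G a b"
    show "eval_chain D (- 1) 1 (mult_X D e ?c) s G' =
        eval_chain D (- 1) 1 (\<lambda>z. (if e \<in> G then b else a) * ?c z) s G'"
    proof (cases "eval_chain D (- 1) 1 ?c s G' = 0")
      case False
      then have so: "s = oriented_state D"
        by (auto simp: eval_canonical_chain[OF wf] split: if_splits)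
      have "(e \<in> G') = ((e \<in> G) = ((a, b) = (- 1, 1)))"
        using eval_canonical_chain_support[OF wf G _ ab _ e, of G'] G' False so by simp
      then have "(if e \<in> G' then 1 else - 1) = (if e \<in> G then b else a)"
        using ab ne by auto
      then show ?thesis
        by (simp only: eval_mult_X[OF wf s G' e] eval_chain_scale)
    qed (simp add: eval_mult_X[OF wf s G' e] eval_chain_scale)
  qed
qed

section \<open>Degrees of the edge maps, and the grading modulo 4\<close>

lemma qdeg_edge:
  assumes wf: "well_formed D" and s: "s \<in> states D" and j: "j \<notin> s"
    and S: "S \<subseteq> circles D s" and T: "T \<subseteq> circles D (insert j s)"
    and C: "C = circles D s" and C': "C' = circles D (insert j s)"
    and eq: "S \<inter> (C \<inter> C') = T \<inter> (C \<inter> C')"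
  shows "qdeg_state D (insert j s, T) = qdeg_state D (s, S) + 1
    + (int (card (C' - C)) - int (card (C - C')))
    - 2 * (int (card (T \<inter> (C' - C))) - int (card (S \<inter> (C - C'))))"
proof -
  have fin: "finite C" "finite C'"
    using partition_of_circles[OF wf] by (auto simp: partition_of_def C C')
  have finS: "finite S" "finite T"
    using S T fin finite_subset C C' by auto
  have split: "card A = card (A \<inter> B) + card (A - B)" if "finite A" for A B :: "nat set set"
    using that card_Int_Diff by blast
  have "card C = card (C \<inter> C') + card (C - C')" "card C' = card (C \<inter> C') + card (C' - C)"
    using split[OF fin(1), of C'] split[OF fin(2), of C] by (simp_all add: Int_commute)
  moreover have "S \<inter> C' = S \<inter> (C \<inter> C')" "S - C' = S \<inter> (C - C')"
    "T \<inter> C = S \<inter> (C \<inter> C')" "T - C = T \<inter> (C' - C)"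
    using S T eq C C' by auto
  then have "card S = card (S \<inter> (C \<inter> C')) + card (S \<inter> (C - C'))"
    "card T = card (S \<inter> (C \<inter> C')) + card (T \<inter> (C' - C))"
    using split[OF finS(1), of C'] split[OF finS(2), of C] by simp_all
  ultimately show ?thesis
    using finite_state[OF s] j by (simp add: qdeg_state_def C[symmetric] C'[symmetric])
qed

text \<open>Terms free of \<open>q\<close> preserve the degree; the terms with \<open>q\<close>,
  namely \<open>1\<close> in \<open>X * X\<close> and \<open>1 \<otimes> 1\<close> in
  \<open>\<Delta>(X)\<close>, raise it by 4.\<close>

lemma edge_coeff_qdeg_mod_4:
  assumes wf: "well_formed D" and s: "s \<in> states D" and j: "j \<notin> s"
    and S: "S \<subseteq> circles D s" and T: "T \<subseteq> circles D (insert j s)"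
    and nz: "edge_coeff D 0 (1::'r::comm_ring_1) s j S T \<noteq> 0"
  shows "4 dvd qdeg_state D (insert j s, T) - qdeg_state D (s, S)"
proof -
  define C C' where C: "C = circles D s" and C': "C' = circles D (insert j s)"
  have fin: "finite C" "finite C'"
    using partition_of_circles[OF wf] by (auto simp: partition_of_def C C')
  have eq: "S \<inter> (C \<inter> C') = T \<inter> (C \<inter> C')"
    using nz by (auto simp: edge_coeff_def Let_def C C' split: if_splits)
  have k: "card (S \<inter> (C - C')) \<le> card (C - C')" and l: "card (T \<inter> (C' - C)) \<le> card (C' - C)"
    using fin by (auto intro!: card_mono)
  note q = qdeg_edge[OF wf s j S T C C' eq]
  consider "card (C - C') = 2" "card (C' - C) = 1"
    "mult_coeff 0 (1::'r) (card (S \<inter> (C - C'))) (card (T \<inter> (C' - C))) \<noteq> 0"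
  | "card (C - C') = 1" "card (C' - C) = 2"
    "comult_coeff 0 (1::'r) (card (S \<inter> (C - C'))) (card (T \<inter> (C' - C))) \<noteq> 0"
    using nz by (auto simp: edge_coeff_def Let_def C C' split: if_splits)
  then show ?thesis
  proof cases
    case 1
    then show ?thesis
      using k l unfolding q by (auto simp: mult_coeff_def split: if_splits)
  next
    case 2
    then have "card (S \<inter> (C - C')) = 0 \<or> card (S \<inter> (C - C')) = 1"
      "card (T \<inter> (C' - C)) = 0 \<or> card (T \<inter> (C' - C)) = 1 \<or> card (T \<inter> (C' - C)) = 2"
      using k l by auto
    then show ?thesis
      using 2 unfolding q by (auto simp: comult_coeff_def split: if_splits)
  qed
qed

definition qdeg_part :: "diagram \<Rightarrow> int \<Rightarrow> 'r::comm_ring_1 chain \<Rightarrow> 'r chain" where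
  "qdeg_part D r x = (\<lambda>e. if 4 dvd qdeg_state D e - r then x e else 0)"

lemma chainsD: "x \<in> chains D \<Longrightarrow> e \<notin> enhanced_states D \<Longrightarrow> x e = 0"
  unfolding chains_def by blast

lemma qdeg_part_diff:
  "qdeg_part D r (\<lambda>e. x e - y e) = (\<lambda>e. qdeg_part D r x e - qdeg_part D r y e)"
  by (rule ext) (simp add: qdeg_part_def)

lemma qdeg_part_in_chains: "x \<in> chains D \<Longrightarrow> qdeg_part D r x \<in> chains D"
  by (auto simp: qdeg_part_def chains_def)

lemma filtered_qdeg_part: "filtered D j x \<Longrightarrow> filtered D j (qdeg_part D r x)"
  by (auto simp: qdeg_part_def filtered_def)

lemma differential_qdeg_part:
  fixes x :: "'r::comm_ring_1 chain"
  assumes wf: "well_formed D"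
  shows "differential D 0 1 (qdeg_part D r x) = qdeg_part D r (differential D 0 1 x)"
proof
  fix e :: enhanced_state
  obtain s T where e: "e = (s, T)" by (cases e)
  show "differential D 0 1 (qdeg_part D r x) e = qdeg_part D r (differential D 0 1 x) e"
  proof (cases "e \<in> enhanced_states D")
    case True
    then have s: "s \<in> states D" and T: "T \<subseteq> circles D s"
      by (auto simp: e enhanced_states_def)
    let ?k = "if 4 dvd qdeg_state D e - r then 1 else (0::'r)"
    have *: "edge_coeff D 0 1 (s - {j}) j S T * qdeg_part D r x (s - {j}, S) =
        ?k * (edge_coeff D 0 1 (s - {j}) j S T * x (s - {j}, S))"
      if j: "j \<in> s" and S: "S \<in> Pow (circles D (s - {j}))" for j S
    proof (cases "edge_coeff D 0 (1::'r) (s - {j}) j S T = 0")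
      case False
      have "insert j (s - {j}) = s" using j by auto
      then have "4 dvd qdeg_state D e - qdeg_state D (s - {j}, S)"
        using edge_coeff_qdeg_mod_4[OF wf Diff_in_states[OF s] _ _ _ False] S T e by auto
      then have "4 dvd (qdeg_state D e - r) \<longleftrightarrow> 4 dvd (qdeg_state D (s - {j}, S) - r)"
        by presburger
      then show ?thesis
        by (simp add: qdeg_part_def)
    qed simp
    have "differential D 0 1 (qdeg_part D r x) e = ?k * differential D 0 1 x e"
      unfolding e differential_apply[OF s T] sum_distrib_left
      by (intro sum.cong refl) (use * in \<open>simp add: e mult.left_commute\<close>)
    then show ?thesis
      by (simp add: qdeg_part_def)
  next
    case False
    then have "differential D 0 1 y e = 0" for y :: "'r chain"
      using differential_in_chains chainsD by blast
    then show ?thesis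
      by (simp add: qdeg_part_def)
  qed
qed

lemma representable_qdeg_part:
  assumes wf: "well_formed D" and "representable D 0 1 x j"
  shows "representable D 0 1 (qdeg_part D r x) j"
  by (rule representable_map[OF qdeg_part_diff differential_qdeg_part[OF wf]
        qdeg_part_in_chains filtered_qdeg_part assms(2)])

text \<open>After projection no term can have degree exactly \<open>j\<close>, so the bound improves
  by one. This confines maximal degrees to their residue.\<close>

lemma representable_qdeg_part_Suc:
  assumes wf: "well_formed D" and "representable D 0 1 x j" and "\<not> 4 dvd j - r"
  shows "representable D 0 1 (qdeg_part D r x) (j + 1)"
proof (rule representable_map[OF qdeg_part_diff differential_qdeg_part[OF wf]
      qdeg_part_in_chains _ assms(2)])
  fix x :: "'a chain" assume x: "filtered D j x"
  show "filtered D (j + 1) (qdeg_part D r x)"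
    unfolding filtered_def
  proof (intro allI impI)
    fix e assume nz: "qdeg_part D r x e \<noteq> 0"
    then have "x e \<noteq> 0" "4 dvd qdeg_state D e - r"
      by (auto simp: qdeg_part_def split: if_splits)
    moreover from this have "j \<le> qdeg_state D e"
      using x unfolding filtered_def by blast
    moreover have "qdeg_state D e \<noteq> j"
      using \<open>4 dvd qdeg_state D e - r\<close> assms(3) by blast
    ultimately show "j + 1 \<le> qdeg_state D e" by simp
  qed
qed

section \<open>Homogenization\<close>

text \<open>
  With \<open>h\<close> in degree \<open>-2\<close> the complex over \<open>F[h]\<close> is graded.  Setting \<open>h = 2\<close>, a homogeneous chain of
  degree \<open>J\<close> becomes a chain over \<open>F\<close> all of whose terms have degree at least \<open>J\<close>: the basis element
  of degree \<open>q = J + 2 k\<close> has coefficient \<open>a h ^ k / 2 ^ k\<close> upstairs and \<open>a\<close> downstairs.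
\<close>

definition in_degree :: "int \<Rightarrow> int \<Rightarrow> bool" where
  "in_degree J q \<longleftrightarrow> J \<le> q \<and> even (q - J)"

text \<open>For inhomogeneous \<open>f\<close> this first projects to the component of total degree
  \<open>J\<close>; only one coefficient of \<open>f\<close> survives.\<close>

definition dehomogenize :: "int \<Rightarrow> int \<Rightarrow> 'f::field poly \<Rightarrow> 'f" where
  "dehomogenize J q f = (if in_degree J q
     then 2 ^ nat ((q - J) div 2) * coeff f (nat ((q - J) div 2)) else 0)"

definition homogenize :: "int \<Rightarrow> int \<Rightarrow> 'f::field \<Rightarrow> 'f poly" where
  "homogenize J q a = (if in_degree J q
     then monom (a / 2 ^ nat ((q - J) div 2)) (nat ((q - J) div 2)) else 0)"

lemma in_degree_iff: "in_degree J q \<longleftrightarrow> (\<exists>k. q = J + 2 * int k)"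
proof
  assume "in_degree J q"
  then show "\<exists>k. q = J + 2 * int k"
    by (intro exI[of _ "nat ((q - J) div 2)"]) (auto simp: in_degree_def)
qed (auto simp: in_degree_def)

lemma dehomogenize_eq [simp]: "dehomogenize J (J + 2 * int k) f = 2 ^ k * coeff f k"
  by (simp add: dehomogenize_def in_degree_def)

lemma homogenize_eq [simp]: "homogenize J (J + 2 * int k) a = monom (a / 2 ^ k) k"
  by (simp add: homogenize_def in_degree_def)

lemma dehomogenize_not_ok: "\<not> in_degree J q \<Longrightarrow> dehomogenize J q f = 0"
  by (simp add: dehomogenize_def)

lemma homogenize_not_ok: "\<not> in_degree J q \<Longrightarrow> homogenize J q a = 0"
  by (simp add: homogenize_def)

lemma dehomogenize_0 [simp]: "dehomogenize J q 0 = 0"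
  by (simp add: dehomogenize_def)

lemma homogenize_0 [simp]: "homogenize J q 0 = 0"
  by (simp add: homogenize_def)

lemma dehomogenize_add: "dehomogenize J q (f + g) = dehomogenize J q f + dehomogenize J q g"
  by (simp add: dehomogenize_def distrib_left)

lemma dehomogenize_diff: "dehomogenize J q (f - g) = dehomogenize J q f - dehomogenize J q g"
  by (simp add: dehomogenize_def right_diff_distrib)

lemma homogenize_add: "homogenize J q (a + b) = homogenize J q a + homogenize J q b"
  by (simp add: homogenize_def add_divide_distrib add_monom)

lemma homogenize_diff: "homogenize J q (a - b) = homogenize J q a - homogenize J q b"
  by (simp add: homogenize_def diff_divide_distrib diff_monom)

lemma dehomogenize_sum: "dehomogenize J q (sum f A) = (\<Sum>i\<in>A. dehomogenize J q (f i))"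
  by (induction A rule: infinite_finite_induct) (auto simp: dehomogenize_add)

lemma homogenize_sum: "homogenize J q (sum f A) = (\<Sum>i\<in>A. homogenize J q (f i))"
  by (induction A rule: infinite_finite_induct) (auto simp: homogenize_add)

lemma dehomogenize_sign: "dehomogenize J q ((- 1) ^ n * f) = (- 1) ^ n * dehomogenize J q f"
  by (cases "even n") (simp_all add: dehomogenize_def)

lemma homogenize_sign: "homogenize J q ((- 1) ^ n * a) = (- 1) ^ n * homogenize J q a"
  by (cases "even n") (simp_all add: homogenize_def minus_monom)

lemma dehomogenize_monom_mult:
  "dehomogenize J (q + 2 * int d) (monom a d * f) = a * 2 ^ d * dehomogenize J q f"
proof (cases "in_degree J (q + 2 * int d)")
  case True
  then obtain k where k: "q + 2 * int d = J + 2 * int k"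
    by (auto simp: in_degree_iff)
  show ?thesis
  proof (cases "d \<le> k")
    case True
    then obtain l where l: "k = d + l" by (auto simp: le_iff_add)
    then have "q = J + 2 * int l" using k by simp
    then show ?thesis
      unfolding k l dehomogenize_eq by (simp add: coeff_monom_mult power_add)
  next
    case False
    then have "\<not> in_degree J q" using k by (auto simp: in_degree_def)
    then show ?thesis
      unfolding k using False by (simp add: coeff_monom_mult dehomogenize_not_ok)
  qed
next
  case False
  then have "\<not> in_degree J q" by (auto simp: in_degree_def)
  then show ?thesis using False by (simp add: dehomogenize_not_ok)
qed

text \<open>If \<open>q\<close> were below \<open>J\<close>, the right side would be 0 while the
  left side could survive once \<open>q + 2 * int d\<close> reaches \<open>J\<close>.\<close>

lemma homogenize_mult:
  assumes "(2::'f::field) \<noteq> 0" and "J \<le> q \<or> b = 0"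
  shows "homogenize J (q + 2 * int d) (a * 2 ^ d * b) = monom a d * homogenize J q (b::'f)"
proof (cases "in_degree J q")
  case True
  then obtain k where k: "q = J + 2 * int k"
    by (auto simp: in_degree_iff)
  have "q + 2 * int d = J + 2 * int (d + k)" using k by simp
  then have "homogenize J (q + 2 * int d) (a * 2 ^ d * b)
      = monom (a * 2 ^ d * b / 2 ^ (d + k)) (d + k)"
    by (simp only: homogenize_eq)
  then show ?thesis
    using assms(1) by (simp add: k mult_monom power_add)
next
  case False
  show ?thesis
  proof (cases "b = 0")
    case False
    then have "\<not> in_degree J (q + 2 * int d)"
      using assms(2) \<open>\<not> in_degree J q\<close> by (auto simp: in_degree_def)
    then show ?thesis
      using \<open>\<not> in_degree J q\<close> by (simp add: homogenize_not_ok)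
  qed simp
qed

text \<open>The terms \<open>h X\<close> of \<open>X * X\<close> and
  \<open>- h 1 \<otimes> 1\<close> of \<open>\<Delta>(1)\<close> have \<open>d = 1\<close>; all
  other nonzero entries are 1 with \<open>d = 0\<close>. So the differential over
  \<open>F[h]\<close> preserves the total degree and specializes correctly.\<close>

lemma edge_coeff_homogeneous:
  assumes wf: "well_formed D" and s: "s \<in> states D" and j: "j \<notin> s"
    and S: "S \<subseteq> circles D s" and T: "T \<subseteq> circles D (insert j s)"
  shows "\<exists>a d. edge_coeff D [:0, 1:] 0 s j S T = monom a d \<and>
    edge_coeff D 2 0 s j S T = (a::'f::field) * 2 ^ d \<and>
    (a \<noteq> 0 \<longrightarrow> qdeg_state D (insert j s, T) = qdeg_state D (s, S) + 2 * int d)"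
proof -
  define C C' where C: "C = circles D s" and C': "C' = circles D (insert j s)"
  have fin: "finite C" "finite C'"
    using finite_circles[OF wf] by (auto simp: C C')
  define k l where kl: "k = card (S \<inter> (C - C'))" "l = card (T \<inter> (C' - C))"
  have k: "k \<le> card (C - C')" and l: "l \<le> card (C' - C)"
    using fin by (auto intro!: card_mono simp: kl)
  show ?thesis
  proof (cases "S \<inter> (C \<inter> C') = T \<inter> (C \<inter> C')")
    case eq: True
    note q = qdeg_edge[OF wf s j S T C C' eq, folded kl]
    have h: "[:0, 1::'f:] = monom 1 1" "[:0, - 1::'f:] = monom (- 1) 1"
      by (simp_all add: monom_altdef)
    consider (merge) "card (C - C') = 2" "card (C' - C) = 1"
      | (split) "card (C - C') = 1" "card (C' - C) = 2"
      | (none) "\<not> (card (C - C') = 2 \<and> card (C' - C) = 1)"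
        "\<not> (card (C - C') = 1 \<and> card (C' - C) = 2)"
      by auto
    then show ?thesis
    proof cases
      case merge
      have e: "edge_coeff D p q s j S T = mult_coeff p q k l" for p q :: "'r::comm_ring_1"
        using merge eq by (simp add: edge_coeff_def Let_def C[symmetric] C'[symmetric] kl)
      consider "k = 2" "l = 0" | "k = 2" "l = 1" | "k < 2" "k = l" | "k < 2" "k \<noteq> l"
        using k l merge by linarith
      then show ?thesis
      proof cases
        case 1
        then show ?thesis unfolding e by (intro exI[of _ 0]) (simp add: mult_coeff_def)
      next
        case 2
        then show ?thesis unfolding e q using merge
          by (intro exI[of _ 1] exI[of _ 1]) (simp add: mult_coeff_def h)
      next
        case 3
        then show ?thesis unfolding e q using merge
          by (intro exI[of _ 1] exI[of _ 0]) (simp add: mult_coeff_def monom_0 one_pCons)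
      next
        case 4
        then show ?thesis unfolding e by (intro exI[of _ 0]) (simp add: mult_coeff_def)
      qed
    next
      case split
      have e: "edge_coeff D p q s j S T = comult_coeff p q k l" for p q :: "'r::comm_ring_1"
        using split eq by (simp add: edge_coeff_def Let_def C[symmetric] C'[symmetric] kl)
      consider "k = 0" "l = 0" | "k = 0" "l = 1" | "k = 0" "l = 2"
        | "k = 1" "l = 0" | "k = 1" "l = 1" | "k = 1" "l = 2"
        using k l split by linarith
      then show ?thesis
      proof cases
        case 1
        then show ?thesis unfolding e q using split
          by (intro exI[of _ "- 1"] exI[of _ 1]) (simp add: comult_coeff_def h minus_monom)
      next
        case 2
        then show ?thesis unfolding e q using split
          by (intro exI[of _ 1] exI[of _ 0]) (simp add: comult_coeff_def monom_0 one_pCons)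
      next
        case 3
        then show ?thesis unfolding e by (intro exI[of _ 0]) (simp add: comult_coeff_def)
      next
        case 4
        then show ?thesis unfolding e by (intro exI[of _ 0]) (simp add: comult_coeff_def)
      next
        case 5
        then show ?thesis unfolding e by (intro exI[of _ 0]) (simp add: comult_coeff_def)
      next
        case 6
        then show ?thesis unfolding e q using split
          by (intro exI[of _ 1] exI[of _ 0]) (simp add: comult_coeff_def monom_0 one_pCons)
      qed
    next
      case none
      then show ?thesis
        by (intro exI[of _ 0]) (auto simp: edge_coeff_def Let_def C[symmetric] C'[symmetric])
    qed
  next
    case False
    then show ?thesis
      by (intro exI[of _ 0]) (auto simp: edge_coeff_def Let_def C[symmetric] C'[symmetric])
  qed
qed

lemma differential_outside: "e \<notin> enhanced_states D \<Longrightarrow> differential D p q x e = 0"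
  by (rule chainsD[OF differential_in_chains])

definition dehomogenize_chain :: "diagram \<Rightarrow> int \<Rightarrow> 'f::field poly chain \<Rightarrow> 'f chain" where
  "dehomogenize_chain D J x = (\<lambda>e. dehomogenize J (qdeg_state D e) (x e))"

definition homogenize_chain :: "diagram \<Rightarrow> int \<Rightarrow> 'f::field chain \<Rightarrow> 'f poly chain" where
  "homogenize_chain D J x = (\<lambda>e. homogenize J (qdeg_state D e) (x e))"

lemma dehomogenize_chain_in_chains: "x \<in> chains D \<Longrightarrow> dehomogenize_chain D J x \<in> chains D"
  by (auto simp: dehomogenize_chain_def chains_def)

lemma homogenize_chain_in_chains: "x \<in> chains D \<Longrightarrow> homogenize_chain D J x \<in> chains D"
  by (auto simp: homogenize_chain_def chains_def)

lemma differential_dehomogenize_chain: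
  fixes x :: "'f::field poly chain"
  assumes wf: "well_formed D"
  shows "differential D 2 0 (dehomogenize_chain D J x) =
    dehomogenize_chain D J (differential D [:0, 1:] 0 x)"
proof
  fix e :: enhanced_state
  obtain s T where e: "e = (s, T)" by (cases e)
  show "differential D 2 0 (dehomogenize_chain D J x) e =
    dehomogenize_chain D J (differential D [:0, 1:] 0 x) e"
  proof (cases "e \<in> enhanced_states D")
    case True
    then have s: "s \<in> states D" and T: "T \<subseteq> circles D s"
      by (auto simp: e enhanced_states_def)
    have "dehomogenize J (qdeg_state D (s, T))
        (edge_coeff D [:0, 1:] 0 (s - {j}) j S T * x (s - {j}, S)) =
        edge_coeff D 2 0 (s - {j}) j S T * dehomogenize_chain D J x (s - {j}, S)"
      if j: "j \<in> s" and S: "S \<in> Pow (circles D (s - {j}))" for j S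
    proof -
      have ins: "insert j (s - {j}) = s" using j by auto
      obtain a d where ad: "edge_coeff D [:0, 1:] 0 (s - {j}) j S T = monom a d"
          "edge_coeff D 2 0 (s - {j}) j S T = (a::'f) * 2 ^ d"
          "a \<noteq> 0 \<Longrightarrow> qdeg_state D (s, T) = qdeg_state D (s - {j}, S) + 2 * int d"
        using edge_coeff_homogeneous[OF wf Diff_in_states[OF s], of j "{j}" S T] S T ins by auto
      show ?thesis
      proof (cases "a = 0")
        case False
        show ?thesis
          unfolding ad(1,2) ad(3)[OF False] dehomogenize_monom_mult
          by (simp add: dehomogenize_chain_def)
      qed (simp add: ad)
    qed
    then show ?thesis
      unfolding e dehomogenize_chain_def[of D J "differential D _ _ _"]
        prod.case differential_apply[OF s T] dehomogenize_sum dehomogenize_sign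
      by (intro sum.cong refl arg_cong2[of _ _ _ _ "(*)"]) simp
  next
    case False
    then show ?thesis
      by (simp add: dehomogenize_chain_def differential_outside)
  qed
qed

text \<open>The filtration hypothesis ensures that homogenizing loses no term below \<open>J\<close>
  whose image would lie in degree \<open>J\<close> or above.\<close>

lemma differential_homogenize_chain:
  fixes x :: "'f::field chain"
  assumes wf: "well_formed D" and two: "(2::'f) \<noteq> 0" and x: "filtered D J x"
  shows "differential D [:0, 1:] 0 (homogenize_chain D J x) =
    homogenize_chain D J (differential D 2 0 x)"
proof
  fix e :: enhanced_state
  obtain s T where e: "e = (s, T)" by (cases e)
  show "differential D [:0, 1:] 0 (homogenize_chain D J x) e =
    homogenize_chain D J (differential D 2 0 x) e"
  proof (cases "e \<in> enhanced_states D")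
    case True
    then have s: "s \<in> states D" and T: "T \<subseteq> circles D s"
      by (auto simp: e enhanced_states_def)
    have "homogenize J (qdeg_state D (s, T))
        (edge_coeff D 2 0 (s - {j}) j S T * x (s - {j}, S)) =
        edge_coeff D [:0, 1:] 0 (s - {j}) j S T * homogenize_chain D J x (s - {j}, S)"
      if j: "j \<in> s" and S: "S \<in> Pow (circles D (s - {j}))" for j S
    proof -
      have ins: "insert j (s - {j}) = s" using j by auto
      obtain a d where ad: "edge_coeff D [:0, 1:] 0 (s - {j}) j S T = monom a d"
          "edge_coeff D 2 0 (s - {j}) j S T = (a::'f) * 2 ^ d"
          "a \<noteq> 0 \<Longrightarrow> qdeg_state D (s, T) = qdeg_state D (s - {j}, S) + 2 * int d"
        using edge_coeff_homogeneous[OF wf Diff_in_states[OF s], of j "{j}" S T] S T ins by auto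
      have le: "J \<le> qdeg_state D (s - {j}, S) \<or> x (s - {j}, S) = 0"
        using x unfolding filtered_def by blast
      show ?thesis
      proof (cases "a = 0")
        case False
        show ?thesis
          unfolding ad(1,2) ad(3)[OF False] homogenize_mult[OF two le]
          by (simp add: homogenize_chain_def)
      qed (simp add: ad)
    qed
    then show ?thesis
      unfolding e homogenize_chain_def[of D J "differential D _ _ _"]
        prod.case differential_apply[OF s T] homogenize_sum homogenize_sign
      by (intro sum.cong refl arg_cong2[of _ _ _ _ "(*)"]) simp
  next
    case False
    then show ?thesis
      by (simp add: homogenize_chain_def differential_outside)
  qed
qed

section \<open>The canonical cycle as a homogeneous element\<close>

definition base_degree :: "diagram \<Rightarrow> int" where
  "base_degree D = writhe D - int (card (seifert_circles D))"

text \<open>The oriented state has \<open>n_minus D\<close> one-resolutions. The lowest degree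
  belongs to the generator with \<open>X\<close> on all circles, and each factor \<open>1\<close>
  adds 2.\<close>

lemma qdeg_oriented_state:
  assumes "well_formed D" "T \<subseteq> seifert_circles D"
  shows "qdeg_state D (oriented_state D, T) =
    base_degree D + 2 * int (card (seifert_circles D - T))"
proof -
  have "finite T"
    using assms finite_circles finite_subset by metis
  then have "card (seifert_circles D - T) = card (seifert_circles D) - card T"
    using assms(2) by (rule card_Diff_subset)
  moreover have "card T \<le> card (seifert_circles D)"
    using assms finite_circles by (intro card_mono) auto
  ultimately show ?thesis
    by (simp add: qdeg_state_def base_degree_def writhe_def n_minus_def oriented_state_def)
qed

lemma canonical_chain_apply:
  assumes wf: "well_formed D" and T: "T \<subseteq> seifert_circles D"
  shows "canonical_chain D G a b (oriented_state D, T) =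
    (\<Prod>c\<in>seifert_circles D - T. if c \<subseteq> G then - a else - b)"
proof -
  have "(\<Prod>c\<in>seifert_circles D - T. if c \<subseteq> G then - a else - b)
        = (\<Prod>c\<in>seifert_circles D. if c \<in> T then 1 else if c \<subseteq> G then - a else - b)"
    using finite_circles[OF wf] by (intro prod.mono_neutral_cong_left) auto
  then show ?thesis
    using T by (simp add: canonical_chain_def)
qed

lemma canonical_chain_outside:
  "canonical_chain D G a b (s, T) \<noteq> 0 \<Longrightarrow> s = oriented_state D \<and> T \<subseteq> seifert_circles D"
  by (auto simp: canonical_chain_def split: if_splits)

lemma canonical_chain_eq_0:
  "\<not> (s = oriented_state D \<and> T \<subseteq> seifert_circles D) \<Longrightarrow> canonical_chain D G a b (s, T) = 0"
  by (auto simp: canonical_chain_def)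

lemma canonical_chain_grade:
  assumes "well_formed D" "canonical_chain D G a b e \<noteq> 0"
  shows "in_degree (base_degree D) (qdeg_state D e)"
  using qdeg_oriented_state[OF assms(1)] canonical_chain_outside[of D G a b "fst e" "snd e"] assms(2)
  by (cases e) (auto simp: in_degree_iff)

lemma prod_monom_1: "(\<Prod>c\<in>B. monom (f c) 1) = monom (\<Prod>c\<in>B. f c :: 'f::comm_ring_1) (card B)"
  by (induction B rule: infinite_finite_induct) (auto simp: mult_monom)

text \<open>Every factor \<open>1\<close> brings a coefficient 0 or \<open>- h\<close>, so the power
  of \<open>h\<close> exactly compensates the rise in degree.\<close>

lemma homogenize_canonical_chain:
  assumes wf: "well_formed D" and two: "(2::'f::field) \<noteq> 0"
  shows "homogenize_chain D (base_degree D) (canonical_chain D G 0 (2::'f)) =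
    canonical_chain D G 0 [:0, 1:]"
proof
  fix e :: enhanced_state
  obtain s T where e: "e = (s, T)" by (cases e)
  show "homogenize_chain D (base_degree D) (canonical_chain D G 0 (2::'f)) e =
    canonical_chain D G 0 [:0, 1:] e"
  proof (cases "s = oriented_state D \<and> T \<subseteq> seifert_circles D")
    case True
    then have s: "s = oriented_state D" and T: "T \<subseteq> seifert_circles D" by auto
    let ?B = "seifert_circles D - T" and ?f = "\<lambda>c. if c \<subseteq> G then 0 else (- 1 :: 'f)"
    have "canonical_chain D G 0 [:0, 1::'f:] e = (\<Prod>c\<in>?B. monom (?f c) 1)"
      unfolding e s canonical_chain_apply[OF wf T] by (intro prod.cong) (auto simp: monom_altdef)
    also have "\<dots> = monom (prod ?f ?B) (card ?B)"
      by (rule prod_monom_1)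
    finally have 1: "canonical_chain D G 0 [:0, 1::'f:] e = monom (prod ?f ?B) (card ?B)" .
    have "canonical_chain D G 0 (2::'f) e = (\<Prod>c\<in>?B. ?f c * 2)"
      unfolding e s canonical_chain_apply[OF wf T] by (intro prod.cong) auto
    also have "\<dots> = prod ?f ?B * 2 ^ card ?B"
      unfolding prod.distrib by simp
    finally have "canonical_chain D G 0 (2::'f) e = prod ?f ?B * 2 ^ card ?B" .
    moreover have "qdeg_state D e = base_degree D + 2 * int (card ?B)"
      unfolding e s by (rule qdeg_oriented_state[OF wf T])
    ultimately show ?thesis
      using two by (simp add: homogenize_chain_def 1)
  next
    case False
    then show ?thesis
      unfolding e homogenize_chain_def canonical_chain_eq_0[OF False] by simp
  qed
qed

section \<open>Divisibility by powers of the indeterminate versus filtration degree\<close>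

lemma poly_split_monom:
  fixes r :: "'f::field poly"
  assumes "r \<noteq> 0"
  shows "\<exists>m r'. r = monom 1 m * r' \<and> coeff r' 0 \<noteq> 0"
proof -
  obtain r' where r': "r = [:- 0, 1:] ^ order 0 r * r'" "\<not> [:- 0, 1:] dvd r'"
    using order_decomp[OF assms, of 0] by auto
  have "[:- 0, 1::'f:] ^ order 0 r = monom 1 (order 0 r)"
    by (simp add: monom_altdef)
  moreover have "coeff r' 0 \<noteq> 0"
    using r'(2) unfolding poly_eq_0_iff_dvd[symmetric] by (simp add: poly_0_coeff_0)
  ultimately show ?thesis
    using r'(1) by metis
qed

text \<open>Positive powers of \<open>h\<close> in \<open>r\<close> leave the degree
  \<open>J\<close>, so only its constant coefficient is seen.\<close>

lemma dehomogenize_mult_homogenize: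
  assumes "(2::'f::field) \<noteq> 0" "in_degree J q \<or> a = 0"
  shows "dehomogenize J q (r * homogenize J q a) = coeff r 0 * (a::'f)"
proof (cases "a = 0")
  case False
  then obtain k where "q = J + 2 * int k"
    using assms(2) by (auto simp: in_degree_iff)
  then show ?thesis
    using assms(1) by (simp add: coeff_monom_mult mult.commute[of r])
qed simp

text \<open>From a boundary \<open>r (\<alpha> - h^k y)\<close> one homogeneous component is taken
  and \<open>h\<close> is set to 2. Writing \<open>r = h^m r'\<close> with \<open>r'\<close> of
  nonzero constant term \<open>c\<close> keeps the coefficient of \<alpha> invertible.\<close>

lemma divisible_imp_representable:
  assumes wf: "well_formed D" and two: "(2::'f::field) \<noteq> 0"
    and div: "divisible_mod_torsion D [:0, 1:] 0 ([:0, 1:] ^ k) (canonical_chain D G 0 [:0, 1::'f:])"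
  shows "representable D 2 0 (canonical_chain D G 0 (2::'f)) (base_degree D + 2 * int k)"
proof -
  let ?h = "[:0, 1::'f:]" and ?j = "base_degree D"
  let ?Ah = "canonical_chain D G 0 ?h" and ?A = "canonical_chain D G 0 (2::'f)"
  have hk: "?h ^ k = monom 1 k"
    by (simp add: monom_altdef)
  obtain y r z where y: "y \<in> cycles D ?h 0" and r: "r \<noteq> 0" and z: "z \<in> chains D"
    and eq: "(\<lambda>e. r * (?Ah e - ?h ^ k * y e)) = differential D ?h 0 z"
    using div by (auto simp: divisible_mod_torsion_def torsion_cycles_def boundaries_def)
  obtain m r' where r': "r = monom 1 m * r'" "coeff r' 0 \<noteq> 0"
    using poly_split_monom[OF r] by auto
  define c where "c = coeff r' 0"
  \<comment> \<open>The factor \<open>h^m\<close> lowers the degree of the homogeneous cycle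
    \<alpha> by \<open>2 m\<close>.\<close>
  define J where "J = ?j - 2 * int m"
  \<comment> \<open>Multiplication by \<open>h^k\<close> must bring this component of
    \<open>r' y\<close> down to the degree of \<alpha>, hence the offset \<open>2 k\<close>.\<close>
  define Y where "Y = dehomogenize_chain D (?j + 2 * int k) (\<lambda>e. r' * y e)"
  have shift: "dehomogenize (i - 2 * int n) q (monom 1 n * f) = 2 ^ n * dehomogenize i q f"
    for i q n and f :: "'f poly"
  proof -
    have "dehomogenize (i - 2 * int n) q' f' = dehomogenize i (q' + 2 * int n) f'"
      for q' and f' :: "'f poly"
      by (simp add: dehomogenize_def in_degree_def algebra_simps)
    then show ?thesis
      using dehomogenize_monom_mult[of "i - 2 * int n" "q - 2 * int n" n 1 f]
      by simp
  qed
  have Ah: "?Ah e = homogenize ?j (qdeg_state D e) (?A e)" for e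
    using fun_cong[OF homogenize_canonical_chain[OF wf two, of G], of e]
    by (simp add: homogenize_chain_def)
  have "differential D 2 0 (dehomogenize_chain D J z) e = 2 ^ m * (c * ?A e - 2 ^ k * Y e)" for e
  proof -
    let ?q = "qdeg_state D e"
    have "differential D 2 0 (dehomogenize_chain D J z) e
        = dehomogenize J ?q (differential D ?h 0 z e)"
      unfolding differential_dehomogenize_chain[OF wf] by (simp add: dehomogenize_chain_def)
    also have "differential D ?h 0 z e = monom 1 m * (r' * ?Ah e - monom 1 k * (r' * y e))"
      unfolding eq[symmetric] r'(1) hk by (simp add: algebra_simps)
    also have "dehomogenize J ?q \<dots>
        = 2 ^ m * (dehomogenize ?j ?q (r' * ?Ah e) - dehomogenize ?j ?q (monom 1 k * (r' * y e)))"
      unfolding J_def shift dehomogenize_diff ..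
    also have "dehomogenize ?j ?q (r' * ?Ah e) = c * ?A e"
      unfolding Ah c_def
      by (rule dehomogenize_mult_homogenize[OF two]) (use canonical_chain_grade[OF wf] in blast)
    also have "dehomogenize ?j ?q (monom 1 k * (r' * y e)) = 2 ^ k * Y e"
      using shift[of "?j + 2 * int k" k] by (simp add: Y_def dehomogenize_chain_def)
    finally show ?thesis .
  qed
  note d = this
  have Y: "Y \<in> chains D" "differential D 2 0 Y = (\<lambda>_. 0)" "filtered D (?j + 2 * int k) Y"
  proof -
    have ry: "(\<lambda>e. r' * y e) \<in> chains D"
      using y by (auto simp: cycles_def chains_def)
    then show "Y \<in> chains D"
      by (simp add: Y_def dehomogenize_chain_in_chains)
    have "differential D ?h 0 y = (\<lambda>_. 0)"
      using y by (simp add: cycles_def)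
    then show "differential D 2 0 Y = (\<lambda>_. 0)"
      unfolding Y_def differential_dehomogenize_chain[OF wf] differential_scale
      by (simp add: dehomogenize_chain_def)
    show "filtered D (?j + 2 * int k) Y"
      by (auto simp: filtered_def Y_def dehomogenize_chain_def dehomogenize_def in_degree_def
          split: if_splits)
  qed
  show ?thesis
  proof (rule representableI)
    let ?y = "\<lambda>e. (2 ^ k / c) * Y e"
    let ?z = "\<lambda>e. (- 1 / (2 ^ m * c)) * dehomogenize_chain D J z e"
    show "?y \<in> chains D"
      using Y by (simp add: chains_def)
    show "differential D 2 0 ?y = (\<lambda>_. 0)"
      unfolding differential_scale Y by simp
    show "filtered D (?j + 2 * int k) ?y"
      using Y(3) unfolding filtered_def by (metis mult_zero_right)
    show "?z \<in> chains D"
      using dehomogenize_chain_in_chains[OF z] by (simp add: chains_def)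
    show "(\<lambda>e. ?y e - ?A e) = differential D 2 0 ?z"
      unfolding differential_scale d using two r'(2) by (auto simp: c_def field_simps)
  qed
qed

text \<open>The bounding chain \<open>z\<close> may have terms below the degree of \<alpha>, so the
  relation is homogenized in the lower degree \<open>J\<close>. This only shows that a multiple of
  \<open>h^M\<close> by a unit annihilates the class of \<open>\<alpha> - h^k Y\<close>, that is,
  divisibility modulo torsion.\<close>

lemma representable_imp_divisible:
  assumes wf: "well_formed D" and G: "seifert_coloring D G" and two: "(2::'f::field) \<noteq> 0"
    and rep: "representable D 2 0 (canonical_chain D G 0 (2::'f)) (base_degree D + 2 * int k)"
  shows "divisible_mod_torsion D [:0, 1:] 0 ([:0, 1:] ^ k) (canonical_chain D G 0 [:0, 1::'f:])"
proof -
  let ?h = "[:0, 1::'f:]" and ?j = "base_degree D"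
  let ?Ah = "canonical_chain D G 0 ?h" and ?A = "canonical_chain D G 0 (2::'f)"
  have hk: "?h ^ k = monom 1 k"
    by (simp add: monom_altdef)
  obtain y z where y: "y \<in> chains D" "differential D 2 0 y = (\<lambda>_. 0)" "filtered D (?j + 2 * int k) y"
    and z: "z \<in> chains D" "(\<lambda>e. y e - ?A e) = differential D 2 0 z"
    using rep by (rule representableE)
  obtain M where M: "\<forall>e\<in>enhanced_states D. ?j - 2 * int M \<le> qdeg_state D e"
  proof -
    \<comment> \<open>Inserting \<open>?j\<close> keeps the minimum at or below it, so that the
      difference turned into a natural number is not truncated.\<close>
    let ?Q = "insert ?j (qdeg_state D ` enhanced_states D)"
    have fin: "finite ?Q"
      using finite_enhanced_states[OF wf] by simp
    have "?j - 2 * int (nat (?j - Min ?Q)) \<le> qdeg_state D e" if "e \<in> enhanced_states D" for e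
    proof -
      have "Min ?Q \<le> qdeg_state D e" "Min ?Q \<le> ?j"
        using fin that by (auto intro!: Min_le)
      then show ?thesis by simp
    qed
    then show ?thesis using that by blast
  qed
  define J where "J = ?j - 2 * int M"
  have shift: "homogenize (i - 2 * int n) q a = monom (1 / 2 ^ n) n * homogenize i q a"
    if "i \<le> q \<or> a = 0" for i q n and a :: 'f
  proof -
    have "homogenize (i - 2 * int n) q a = homogenize i (q + 2 * int n) a"
      by (simp add: homogenize_def in_degree_def algebra_simps)
    also have "\<dots> = homogenize i (q + 2 * int n) (1 / 2 ^ n * 2 ^ n * a)"
      using two by simp
    also have "\<dots> = monom (1 / 2 ^ n) n * homogenize i q a"
      by (rule homogenize_mult[OF two that])
    finally show ?thesis .
  qed
  \<comment> \<open>Homogenizing \<open>y\<close> in a degree lower by \<open>2 k\<close> multiplies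
    it by \<open>h^k / 2^k\<close>; the constant is absorbed here.\<close>
  define Y where "Y = (\<lambda>e. monom (1 / 2 ^ k) 0 * homogenize_chain D (?j + 2 * int k) y e)"
  have Jz: "filtered D J z"
    unfolding filtered_def J_def using M chainsD[OF z(1)] by blast
  have "differential D ?h 0 (homogenize_chain D J z) e = homogenize J (qdeg_state D e) (y e - ?A e)"
    for e
    unfolding differential_homogenize_chain[OF wf two Jz] z(2)[symmetric]
    by (simp add: homogenize_chain_def)
  also have "homogenize J (qdeg_state D e) (y e - ?A e)
      = - monom (1 / 2 ^ M) M * (?Ah e - monom 1 k * Y e)" for e
  proof -
    let ?q = "qdeg_state D e"
    have "homogenize J ?q (?A e) = monom (1 / 2 ^ M) M * homogenize ?j ?q (?A e)"
      unfolding J_def using canonical_chain_grade[OF wf, of G 0 2 e]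
      by (intro shift) (auto simp: in_degree_def)
    also have "homogenize ?j ?q (?A e) = ?Ah e"
      using fun_cong[OF homogenize_canonical_chain[OF wf two, of G], of e]
      by (simp add: homogenize_chain_def)
    finally have 1: "homogenize J ?q (?A e) = monom (1 / 2 ^ M) M * ?Ah e" .
    have "?j + 2 * int k \<le> ?q \<or> y e = 0"
      using y(3) unfolding filtered_def by blast
    moreover have "J = ?j + 2 * int k - 2 * int (M + k)"
      by (simp add: J_def)
    ultimately have "homogenize J ?q (y e)
        = monom (1 / 2 ^ (M + k)) (M + k) * homogenize (?j + 2 * int k) ?q (y e)"
      using shift by metis
    also have "monom (1 / 2 ^ (M + k) :: 'f) (M + k) = monom (1 / 2 ^ M) M * (monom 1 k * monom (1 / 2 ^ k) 0)"
      by (simp add: mult_monom power_add)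
    finally have 2: "homogenize J ?q (y e) = monom (1 / 2 ^ M) M * (monom 1 k * Y e)"
      by (simp add: Y_def homogenize_chain_def mult.assoc)
    show ?thesis
      unfolding homogenize_diff 1 2 by (simp add: algebra_simps)
  qed
  finally have d: "differential D ?h 0 (homogenize_chain D J z)
      = (\<lambda>e. - monom (1 / 2 ^ M) M * (?Ah e - monom 1 k * Y e))"
    by (rule ext)
  have "homogenize_chain D (?j + 2 * int k) (differential D 2 0 y) = (\<lambda>_. 0)"
    by (simp add: y homogenize_chain_def)
  then have Y: "Y \<in> cycles D ?h 0"
    using homogenize_chain_in_chains[OF y(1)]
    by (simp add: cycles_def Y_def differential_scale differential_homogenize_chain[OF wf two y(3)]
        chains_def)
  have Ah: "?Ah \<in> cycles D ?h 0"
    by (rule canonical_chain_cycle[OF wf G, of 0 ?h]) simp_all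
  have "(\<lambda>e. ?Ah e - monom 1 k * Y e) \<in> cycles D ?h 0"
    using Y Ah by (simp add: cycles_def differential_diff differential_scale chains_def)
  moreover have "(\<lambda>e. monom (1 / 2 ^ M) M * (?Ah e - monom 1 k * Y e)) \<in> boundaries D ?h 0"
    unfolding boundaries_def
  proof (rule image_eqI)
    show "(\<lambda>e. (- 1) * homogenize_chain D J z e) \<in> chains D"
      using homogenize_chain_in_chains[OF z(1)] by (simp add: chains_def)
    show "(\<lambda>e. monom (1 / 2 ^ M) M * (?Ah e - monom 1 k * Y e))
        = differential D ?h 0 (\<lambda>e. (- 1) * homogenize_chain D J z e)"
      unfolding differential_scale d by simp
  qed
  moreover have "monom (1 / 2 ^ M :: 'f) M \<noteq> 0"
    using two by simp
  ultimately show ?thesis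
    unfolding divisible_mod_torsion_def torsion_cycles_def hk using Y by blast
qed

section \<open>The two invariants\<close>

lemma nonzero_chain_qdeg:
  assumes wf: "well_formed D" and x: "x \<in> chains D" "x \<noteq> (\<lambda>_. 0)"
  shows "qdeg_chain D x \<in> qdeg_state D ` enhanced_states D"
    and "filtered D j x \<longleftrightarrow> j \<le> qdeg_chain D x"
proof -
  let ?E = "{e \<in> enhanced_states D. x e \<noteq> 0}"
  have fin: "finite ?E"
    using finite_enhanced_states[OF wf] by simp
  obtain e where e: "x e \<noteq> 0"
    using x(2) by (auto simp: fun_eq_iff)
  then have "e \<in> ?E"
    using chainsD[OF x(1)] by blast
  then have ne: "?E \<noteq> {}" by blast
  have "qdeg_chain D x \<in> qdeg_state D ` ?E"
    unfolding qdeg_chain_def using fin ne by (intro Min_in) auto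
  then show "qdeg_chain D x \<in> qdeg_state D ` enhanced_states D"
    by auto
  have "filtered D j x \<longleftrightarrow> (\<forall>e\<in>?E. j \<le> qdeg_state D e)"
    unfolding filtered_def using chainsD[OF x(1)] by blast
  also have "\<dots> \<longleftrightarrow> j \<le> qdeg_chain D x"
    unfolding qdeg_chain_def using fin ne by (subst Min_ge_iff) auto
  finally show "filtered D j x \<longleftrightarrow> j \<le> qdeg_chain D x" .
qed

text \<open>As \<open>x\<close> is not a boundary, no representative is zero. Their degrees lie in
  the finite set of degrees of enhanced states, so the maximum is attained even if the class is
  infinite.\<close>

lemma representable_iff_le_qdeg_class:
  assumes wf: "well_formed D" and x: "x \<in> cycles D p q" "x \<notin> boundaries D p q"
  shows "representable D p q x j \<longleftrightarrow> j \<le> qdeg_class D (homology_class D p q x)"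
proof -
  let ?H = "homology_class D p q x"
  have y: "y \<in> chains D" "y \<noteq> (\<lambda>_. 0)" if "y \<in> ?H" for y
  proof -
    show "y \<in> chains D"
      using that by (simp add: homology_class_def cycles_def)
    show "y \<noteq> (\<lambda>_. 0)"
    proof
      assume y0: "y = (\<lambda>_. 0)"
      have "(\<lambda>e. y e - x e) \<in> boundaries D p q"
        using that by (simp add: homology_class_def)
      then obtain z where z: "z \<in> chains D" "(\<lambda>e. - x e) = differential D p q z"
        unfolding boundaries_def y0 diff_0 by blast
      have "x = differential D p q (\<lambda>e. (- 1) * z e)"
        unfolding differential_scale z(2)[symmetric] by simp
      moreover have "(\<lambda>e. (- 1) * z e) \<in> chains D"
        using z(1) by (simp add: chains_def)
      ultimately show False
        using x(2) unfolding boundaries_def by blast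
    qed
  qed
  have "(\<lambda>_. 0) = differential D p q (\<lambda>_. 0)"
    using differential_scale[of D p q 0 "\<lambda>_. 0"] by simp
  moreover have "(\<lambda>_. 0) \<in> chains D"
    by (simp add: chains_def)
  ultimately have "(\<lambda>_. 0) \<in> boundaries D p q"
    unfolding boundaries_def by blast
  then have "x \<in> ?H"
    using x(1) by (simp add: homology_class_def)
  moreover have "finite (qdeg_chain D ` ?H)"
  proof (rule finite_subset)
    show "qdeg_chain D ` ?H \<subseteq> qdeg_state D ` enhanced_states D"
      using nonzero_chain_qdeg(1)[OF wf y] by blast
  qed (use finite_enhanced_states[OF wf] in simp)
  ultimately have "j \<le> qdeg_class D ?H \<longleftrightarrow> (\<exists>y\<in>?H. j \<le> qdeg_chain D y)"
    unfolding qdeg_class_def by (subst Max_ge_iff) auto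
  also have "\<dots> \<longleftrightarrow> representable D p q x j"
    unfolding representable_def using nonzero_chain_qdeg(2)[OF wf y] by blast
  finally show ?thesis by simp
qed

lemma mult_X_add: "mult_X D e (\<lambda>z. x z + y z) = (\<lambda>z. mult_X D e x z + mult_X D e y z)"
  by (rule ext) (auto simp: mult_X_def split: prod.split)

text \<open>Exchanging 1 and -1 changes one sign for each circle with factor \<open>1\<close>, and
  there are \<open>(qdeg_state D e - base_degree D) div 2\<close> of these.\<close>

lemma canonical_chain_opposite:
  assumes wf: "well_formed D"
  shows "even ((qdeg_state D e - base_degree D) div 2) \<Longrightarrow>
      canonical_chain D G 1 (- 1) e = (canonical_chain D G (- 1) 1 e :: 'r::comm_ring_1)"
    and "odd ((qdeg_state D e - base_degree D) div 2) \<Longrightarrow>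
      canonical_chain D G 1 (- 1) e = - (canonical_chain D G (- 1) 1 e :: 'r::comm_ring_1)"
proof -
  let ?a = "canonical_chain D G (- 1) 1 e :: 'r" and ?b = "canonical_chain D G 1 (- 1) e :: 'r"
  obtain s T where e: "e = (s, T)" by (cases e)
  have *: "?b = (if even ((qdeg_state D e - base_degree D) div 2) then ?a else - ?a)"
  proof (cases "s = oriented_state D \<and> T \<subseteq> seifert_circles D")
    case True
    then have s: "s = oriented_state D" and T: "T \<subseteq> seifert_circles D" by auto
    let ?B = "seifert_circles D - T"
    have "?b = (\<Prod>c\<in>?B. (- 1) * (if c \<subseteq> G then - (- 1) else - 1))"
      unfolding e s canonical_chain_apply[OF wf T] by (intro prod.cong) auto
    also have "\<dots> = (- 1) ^ card ?B * ?a"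
      unfolding e s canonical_chain_apply[OF wf T] prod.distrib by simp
    finally show ?thesis
      unfolding e s qdeg_oriented_state[OF wf T] by (simp add: e s)
  next
    case False
    then show ?thesis
      by (simp add: e canonical_chain_eq_0)
  qed
  show "even ((qdeg_state D e - base_degree D) div 2) \<Longrightarrow> ?b = ?a"
    "odd ((qdeg_state D e - base_degree D) div 2) \<Longrightarrow> ?b = - ?a"
    using * by simp_all
qed

section \<open>The degrees of the two Lee classes\<close>

locale lee_classes =
  fixes D :: diagram and G :: "nat set" and a b :: "'f::field chain" and QP QM :: int
  assumes knot: "knot_diagram D" and coloring: "seifert_coloring D G" and two: "(2::'f) \<noteq> 0"
  defines "a \<equiv> canonical_chain D G (- 1) 1" and "b \<equiv> canonical_chain D G 1 (- 1)"
    and "QP \<equiv> qdeg_class D (homology_class D 0 1 (\<lambda>e. a e + b e))"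
    and "QM \<equiv> qdeg_class D (homology_class D 0 1 (\<lambda>e. a e - b e))"
begin

lemma wf: "well_formed D"
  by (rule knot_diagram_well_formed[OF knot])

lemma one_ne: "(- 1::'f) \<noteq> 1"
  by (rule one_neq_minus_one[OF two])

lemma cycle: "a \<in> cycles D 0 1" "b \<in> cycles D 0 1"
  unfolding a_def b_def
  by (rule canonical_chain_cycle[OF wf coloring one_ne]; simp)+

lemma cycle_pm: "(\<lambda>e. a e + b e) \<in> cycles D 0 1" "(\<lambda>e. a e - b e) \<in> cycles D 0 1"
  using cycle by (auto simp: cycles_def differential_add differential_diff chains_def)

text \<open>Evaluation at \<open>G\<close> kills boundaries and \<open>b\<close> but not
  \<open>a\<close>.\<close>

lemma not_boundary: "(\<lambda>e. a e + b e) \<notin> boundaries D 0 1" "(\<lambda>e. a e - b e) \<notin> boundaries D 0 1"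
proof -
  have ne: "edges D \<noteq> {}"
    using knot by (simp add: knot_diagram_def)
  have "eval_chain D (- 1) 1 a (oriented_state D) G \<noteq> 0"
    "eval_chain D (- 1) 1 b (oriented_state D) G = 0"
    unfolding a_def b_def
    by (rule eval_canonical_chain_nonzero[OF wf one_ne] eval_canonical_chain_opposite[OF wf ne])+
  then have "eval_chain D (- 1) 1 (\<lambda>e. a e + b e) (oriented_state D) G \<noteq> 0"
    "eval_chain D (- 1) 1 (\<lambda>e. a e - b e) (oriented_state D) G \<noteq> 0"
    by (simp_all add: eval_chain_add eval_chain_diff)
  then show "(\<lambda>e. a e + b e) \<notin> boundaries D 0 1" "(\<lambda>e. a e - b e) \<notin> boundaries D 0 1"
    using eval_boundary_seifert[OF wf coloring, of 0 "- 1" 1 1] by auto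
qed

lemma representable_P: "representable D 0 1 (\<lambda>e. a e + b e) j \<longleftrightarrow> j \<le> QP"
  unfolding QP_def by (rule representable_iff_le_qdeg_class[OF wf cycle_pm(1) not_boundary(1)])

lemma representable_M: "representable D 0 1 (\<lambda>e. a e - b e) j \<longleftrightarrow> j \<le> QM"
  unfolding QM_def by (rule representable_iff_le_qdeg_class[OF wf cycle_pm(2) not_boundary(2)])

lemma parity:
  "a e + b e \<noteq> 0 \<Longrightarrow> 4 dvd qdeg_state D e - base_degree D"
  "a e - b e \<noteq> 0 \<Longrightarrow> 4 dvd qdeg_state D e - (base_degree D + 2)"
proof -
  let ?d = "qdeg_state D e - base_degree D"
  have ev: "even ?d" if "a e \<noteq> 0 \<or> b e \<noteq> 0"
    using that canonical_chain_grade[OF wf] unfolding a_def b_def in_degree_def by blast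
  have E: "b e = a e" if "even (?d div 2)"
    using canonical_chain_opposite(1)[OF wf that] by (simp add: a_def b_def)
  have O: "b e = - a e" if "odd (?d div 2)"
    using canonical_chain_opposite(2)[OF wf that] by (simp add: a_def b_def)
  show "4 dvd ?d" if "a e + b e \<noteq> 0"
  proof -
    have "even (?d div 2)" using O that by fastforce
    moreover have "a e \<noteq> 0 \<or> b e \<noteq> 0" using that by auto
    then have "even ?d" by (rule ev)
    ultimately show ?thesis by presburger
  qed
  show "4 dvd qdeg_state D e - (base_degree D + 2)" if "a e - b e \<noteq> 0"
  proof -
    have "odd (?d div 2)" using E that by fastforce
    moreover have "a e \<noteq> 0 \<or> b e \<noteq> 0" using that by auto
    then have "even ?d" by (rule ev)
    ultimately show ?thesis by presburger
  qed
qed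

lemma part_P: "qdeg_part D (base_degree D) (\<lambda>e. a e + b e) = (\<lambda>e. a e + b e)"
proof
  show "qdeg_part D (base_degree D) (\<lambda>e. a e + b e) e = a e + b e" for e
    using parity(1)[of e] by (auto simp: qdeg_part_def)
qed

lemma part_M: "qdeg_part D (base_degree D + 2) (\<lambda>e. a e - b e) = (\<lambda>e. a e - b e)"
proof
  show "qdeg_part D (base_degree D + 2) (\<lambda>e. a e - b e) e = a e - b e" for e
    using parity(2)[of e] by (auto simp: qdeg_part_def)
qed

text \<open>Otherwise projecting an optimal representative to the residue of the class would give
  one of higher degree.\<close>

lemma QP_mod_4: "4 dvd QP - base_degree D"
proof (rule ccontr)
  assume "\<not> ?thesis"
  from representable_qdeg_part_Suc[OF wf _ this, of "\<lambda>e. a e + b e"]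
  show False
    by (simp add: part_P representable_P)
qed

lemma QM_mod_4: "4 dvd QM - (base_degree D + 2)"
proof (rule ccontr)
  assume "\<not> ?thesis"
  from representable_qdeg_part_Suc[OF wf _ this, of "\<lambda>e. a e - b e"]
  show False
    by (simp add: part_M representable_M)
qed

text \<open>The sum and difference are twice the projections of \<open>a\<close> to the two
  residues, and projections respect the filtration; conversely \<open>a\<close> is half of their
  total.\<close>

lemma representable_a: "representable D 0 1 a j \<longleftrightarrow> j \<le> QP \<and> j \<le> QM"
proof
  assume rep: "representable D 0 1 a j"
  have "(\<lambda>e. 2 * qdeg_part D (base_degree D) a e) = (\<lambda>e. a e + b e)"
  proof
    fix e
    show "2 * qdeg_part D (base_degree D) a e = a e + b e"
    proof (cases "4 dvd qdeg_state D e - base_degree D")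
      case True
      then have "\<not> 4 dvd qdeg_state D e - (base_degree D + 2)" by presburger
      then have "a e - b e = 0" using parity(2)[of e] by blast
      then show ?thesis using True by (simp add: qdeg_part_def)
    next
      case False
      then have "a e + b e = 0" using parity(1)[of e] by blast
      then show ?thesis using False by (simp add: qdeg_part_def)
    qed
  qed
  then have "representable D 0 1 (\<lambda>e. a e + b e) j"
    using representable_scale[OF representable_qdeg_part[OF wf rep, of "base_degree D"], of 2] by simp
  moreover have "(\<lambda>e. 2 * qdeg_part D (base_degree D + 2) a e) = (\<lambda>e. a e - b e)"
  proof
    fix e
    show "2 * qdeg_part D (base_degree D + 2) a e = a e - b e"
    proof (cases "4 dvd qdeg_state D e - (base_degree D + 2)")
      case True
      then have "\<not> 4 dvd qdeg_state D e - base_degree D" by presburger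
      then have "a e + b e = 0" using parity(1)[of e] by blast
      then have "b e = - a e" by (simp add: add_eq_0_iff)
      then show ?thesis using True by (simp add: qdeg_part_def)
    next
      case False
      then have "a e - b e = 0" using parity(2)[of e] by blast
      then show ?thesis using False by (simp add: qdeg_part_def)
    qed
  qed
  then have "representable D 0 1 (\<lambda>e. a e - b e) j"
    using representable_scale[OF representable_qdeg_part[OF wf rep, of "base_degree D + 2"], of 2]
    by simp
  ultimately show "j \<le> QP \<and> j \<le> QM"
    by (simp add: representable_P representable_M)
next
  assume "j \<le> QP \<and> j \<le> QM"
  then have "representable D 0 1 (\<lambda>e. (a e + b e) + (a e - b e)) j"
    by (intro representable_add[of _ _ _ "\<lambda>e. a e + b e" _ "\<lambda>e. a e - b e"])
      (simp_all only: representable_P representable_M)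
  from representable_scale[OF this, of "1 / 2"] show "representable D 0 1 a j"
    using two by (simp add: field_simps)
qed

lemma QP_QM_close: "QP - 2 \<le> QM" "QM - 2 \<le> QP"
proof -
  obtain e where e: "e \<in> edges D"
    using knot by (auto simp: knot_diagram_def)
  define k :: 'f where "k = (if e \<in> G then 1 else - 1)"
  have kk: "k * k = 1" by (simp add: k_def)
  have a: "mult_X D e a = (\<lambda>z. k * a z)" and b: "mult_X D e b = (\<lambda>z. - k * b z)"
    unfolding a_def b_def k_def
    using mult_X_canonical_chain[OF wf coloring two e, of "- 1" 1]
      mult_X_canonical_chain[OF wf coloring two e, of 1 "- 1"] by auto
  have P: "mult_X D e (\<lambda>z. a z + b z) = (\<lambda>z. k * (a z - b z))"
    unfolding mult_X_add a b by (auto simp: algebra_simps)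
  have M: "mult_X D e (\<lambda>z. a z - b z) = (\<lambda>z. k * (a z + b z))"
    unfolding mult_X_diff a b by (auto simp: algebra_simps)
  have "representable D 0 1 (mult_X D e (\<lambda>z. a z + b z)) (QP - 2)"
    by (rule representable_mult_X[OF wf two e]) (simp add: representable_P)
  from representable_scale[OF this, of k]
  \<comment> \<open>A second factor \<open>k\<close> undoes the sign, as
    \<open>k * k = 1\<close>.\<close>
  have "representable D 0 1 (\<lambda>z. k * (k * (a z - b z))) (QP - 2)"
    unfolding P .
  then show "QP - 2 \<le> QM"
    by (simp add: mult.assoc[symmetric] kk representable_M)
  have "representable D 0 1 (mult_X D e (\<lambda>z. a z - b z)) (QM - 2)"
    by (rule representable_mult_X[OF wf two e]) (simp add: representable_M)
  from representable_scale[OF this, of k]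
  have "representable D 0 1 (\<lambda>z. k * (k * (a z + b z))) (QM - 2)"
    unfolding M .
  then show "QM - 2 \<le> QP"
    by (simp add: mult.assoc[symmetric] kk representable_P)
qed

lemma divisible_iff:
  "divisible_mod_torsion D [:0, 1:] 0 ([:0, 1:] ^ k) (canonical_chain D G 0 [:0, 1::'f:]) \<longleftrightarrow>
    base_degree D + 2 * int k \<le> QP \<and> base_degree D + 2 * int k \<le> QM"
proof -
  let ?j = "base_degree D + 2 * int k" and ?a = "canonical_chain D G 0 (2::'f)"
  have "divisible_mod_torsion D [:0, 1:] 0 ([:0, 1:] ^ k) (canonical_chain D G 0 [:0, 1::'f:]) \<longleftrightarrow>
      representable D 2 0 ?a ?j"
    using divisible_imp_representable[OF wf two] representable_imp_divisible[OF wf coloring two]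
    by blast
  \<comment> \<open>The shifts by 1 and by -1 pass between the roots \<open>0\<close>,
    \<open>2\<close> and \<open>-1\<close>, \<open>1\<close>.\<close>
  also have "\<dots> \<longleftrightarrow> representable D 0 1 a ?j"
  proof
    assume "representable D 2 0 ?a ?j"
    then show "representable D 0 1 a ?j"
      using representable_shift_chain[OF wf one_ne, of 1 ?a ?j]
        shift_canonical_chain[OF wf one_ne, of 1 G "- 1" 1] by (simp add: a_def)
  next
    assume "representable D 0 1 a ?j"
    then show "representable D 2 0 ?a ?j"
      using representable_shift_chain[OF wf, of 0 "2::'f" "- 1" a ?j] two
        shift_canonical_chain[OF wf, of 0 "2::'f" "- 1" G 0 2] by (simp add: a_def)
  qed
  finally show ?thesis
    by (simp only: representable_a)
qed

lemma QP_plus_QM: "QP + QM = 2 * (base_degree D + 2 * int (k_h TYPE('f) D) + 1)"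
proof -
  define m where "m = min QP QM"
  have le_m: "j \<le> QP \<and> j \<le> QM \<longleftrightarrow> j \<le> m" for j
    by (auto simp: m_def)
  have sum: "QP + QM = 2 * m + 2" and ev: "even (m - base_degree D)"
  proof -
    \<comment> \<open>At most 2 apart and congruent to 2 modulo 4 apart. The mean thus exceeds the
      minimum by 1, which is the summand 1 in \<open>s_bar_h\<close>.\<close>
    have "QP - QM = 2 \<or> QM - QP = 2"
      using QP_QM_close QP_mod_4 QM_mod_4 by presburger
    then show "QP + QM = 2 * m + 2"
      by (auto simp: m_def)
    show "even (m - base_degree D)"
      using QP_mod_4 QM_mod_4 unfolding m_def min_def by presburger
  qed
  \<comment> \<open>\<open>a\<close> represents its own class, so the minimum is at least
    \<open>base_degree D\<close> and the \<open>k\<close> chosen below is a natural number.\<close>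
  have "filtered D (base_degree D) a"
    using canonical_chain_grade[OF wf] unfolding filtered_def a_def in_degree_def by blast
  then have "representable D 0 1 a (base_degree D)"
    using cycle(1) differential_scale[of D 0 1 0 "\<lambda>_. 0 :: 'f"]
    by (intro representableI[of a _ _ _ _ "\<lambda>_. 0"]) (auto simp: cycles_def chains_def)
  then have "base_degree D \<le> m"
    by (simp add: representable_a le_m)
  then obtain k where k: "m = base_degree D + 2 * int k"
    using ev in_degree_iff[of "base_degree D" m] by (auto simp: in_degree_def)
  have "k_h TYPE('f) D = (GREATEST i. base_degree D + 2 * int i \<le> m)"
    unfolding k_h_def Let_def alpha_eq_canonical[OF coloring] divisible_iff le_m ..
  also have "\<dots> = k"
    by (rule Greatest_equality) (simp_all add: k)
  finally show ?thesis
    using sum k by simp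
qed

end

theorem theorem3:
  fixes K :: diagram
  assumes "CHAR('f::field) \<noteq> 2"
    and "knot_diagram K"
  shows "s_invariant TYPE('f) K = of_int (s_bar_h TYPE('f) K)"
proof -
  obtain G where G: "seifert_coloring K G"
    using seifert_coloring_exists[OF assms(2)] by auto
  have two: "(2::'f) \<noteq> 0"
  proof
    assume "(2::'f) = 0"
    then have "CHAR('f) dvd 2"
      using of_nat_eq_0_iff_char_dvd[of 2, where ?'a = 'f] by simp
    then have "CHAR('f) = 1 \<or> CHAR('f) = 2"
      using two_is_prime_nat prime_nat_iff by blast
    then show False
      using assms(1) CHAR_not_1[where ?'a = 'f] by simp
  qed
  interpret lee_classes K G "canonical_chain K G (- 1) (1::'f)" "canonical_chain K G 1 (- 1)"
    "qdeg_class K (homology_class K 0 1 (\<lambda>e. canonical_chain K G (- 1) (1::'f) e +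
        canonical_chain K G 1 (- 1) e))"
    "qdeg_class K (homology_class K 0 1 (\<lambda>e. canonical_chain K G (- 1) (1::'f) e -
        canonical_chain K G 1 (- 1) e))"
    by unfold_locales (use assms(2) G two in auto)
  have "s_invariant TYPE('f) K = of_int (base_degree K + 2 * int (k_h TYPE('f) K) + 1)"
    unfolding s_invariant_def Let_def alpha_eq_canonical[OF G] beta_eq_canonical[OF G]
      of_int_add[symmetric] QP_plus_QM by simp
  also have "base_degree K + 2 * int (k_h TYPE('f) K) + 1 = s_bar_h TYPE('f) K"
    by (simp add: s_bar_h_def base_degree_def)
  finally show ?thesis .
qed

end
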